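(* Let $T\in\mathcal{L}(H)$ be Moore-Penrose invertible and have the polar decomposition $T=U|T|$. Then for any $n\in\mathbb{N}$, $T$ is $n$-centered if and only if its Moore-Penrose inverse $T^\dag$ is $n$-centered.
   Context: $\mathbb{N}$ is the set of positive integers. $\mathfrak{A}$ is a $C^*$-algebra, $H$ is a (right) Hilbert $\mathfrak{A}$-module, and $\mathcal{L}(H)$ is the $C^*$-algebra of adjointable operators on $H$. For $T\in\mathcal{L}(H)$, $|T|=(T^*T)^{1/2}$, and $\mathcal{R}(T)$ is the range of $T$. A closed submodule $M\subseteq H$ is orthogonally complemented if $H=M\dotplus M^\perp$; then $P_M$ denotes the projection from $H$ onto $M$. An element $W\in\mathcal{L}(H)$ is a partial isometry if $W^*W$ is a projection. "$T=U|T|$ is the polar decomposition of $T$" means: $U\in\mathcal{L}(H)$ is a partial isometry, $T=U|T|$, $\overline{\mathcal{R}(T^* )}$ is orthogonally complemented, and $U^*U=P_{\overline{\mathcal{R}(T^* )}}$. (Such a $U$ is unique when it exists, and it exists if and only if both $\overline{\mathcal{R}(T^* )}$ and $\overline{\mathcal{R}(T)}$ are orthogonally complemented.) If $T$ has the polar decomposition $T=U|T|$ and $n\in\mathbb{N}$, then $T$ is called $n$-centered if $T^k=U^k|T^k|$ is the polar decomposition of $T^k$ for $k=1,2,\dots,n$. The Moore-Penrose inverse $T^\dag$ of $T\in\mathcal{L}(H)$, if it exists, is the unique $X\in\mathcal{L}(H)$ with $TXT=T$, $XTX=X$, $(TX)^*=TX$, $(XT)^*=XT$; $T$ is called Moore-Penrose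 invertible if $T^\dag$ exists (equivalently, $\mathcal{R}(T)$ is closed). *)

theory Defs
  imports "HOL-Analysis.Analysis"
begin

section \<open>C*-algebras\<close>

class scaleC =
  fixes scaleC :: "complex \<Rightarrow> 'a \<Rightarrow> 'a"  (infixr \<open>*\<^sub>C\<close> 75)

text \<open>The real structure inherited from the library classes is the restriction of the complex one.\<close>

class complex_normed_vector = real_normed_vector + scaleC +
  assumes scaleC_add_right: "c *\<^sub>C (x + y) = c *\<^sub>C x + c *\<^sub>C y"
    and scaleC_add_left: "(c + d) *\<^sub>C x = c *\<^sub>C x + d *\<^sub>C x"
    and scaleC_scaleC: "c *\<^sub>C d *\<^sub>C x = (c * d) *\<^sub>C x"
    and scaleC_of_real: "complex_of_real r *\<^sub>C x = r *\<^sub>R x"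
    and norm_scaleC: "norm (c *\<^sub>C x) = cmod c * norm x"

class complex_banach = complex_normed_vector + complete_space

subclass (in complex_banach) banach ..

text \<open>No unit is assumed, and the zero algebra is allowed.\<close>

class cstar_algebra = complex_banach + real_normed_algebra +
  fixes star :: "'a \<Rightarrow> 'a"
  assumes scaleC_mult_left: "(c *\<^sub>C x) * y = c *\<^sub>C (x * y)"
    and scaleC_mult_right: "x * (c *\<^sub>C y) = c *\<^sub>C (x * y)"
    and star_add: "star (x + y) = star x + star y"
    and star_scaleC: "star (c *\<^sub>C x) = cnj c *\<^sub>C star x"
    and star_mult: "star (x * y) = star y * star x"
    and star_star: "star (star x) = x"
    and cstar_identity: "norm (star x * x) = (norm x)\<^sup>2"

definition cstar_positive :: "'a::cstar_algebra \<Rightarrow> bool"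
  where "cstar_positive a \<longleftrightarrow> (\<exists>b. a = star b * b)"


section \<open>Hilbert C*-modules\<close>

text \<open>
  The Hilbert module is the whole type \<open>'h\<close>, over the C*-algebra \<open>'a\<close>. Inner products are linear
  in the second variable. The norm of \<open>'h\<close> is required to be the one induced by the inner product,
  so that completeness of \<open>'h\<close> is completeness of the module.
\<close>

locale hilbert_module =
  fixes act :: "'h::complex_banach \<Rightarrow> 'a::cstar_algebra \<Rightarrow> 'h"  (infixl \<open>\<odot>\<close> 75)
    and ip :: "'h \<Rightarrow> 'h \<Rightarrow> 'a"
  assumes act_add_left: "(x + y) \<odot> a = x \<odot> a + y \<odot> a"
    and act_add_right: "x \<odot> (a + b) = x \<odot> a + x \<odot> b"
    and act_act: "(x \<odot> a) \<odot> b = x \<odot> (a * b)"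
    and act_scaleC_left: "(c *\<^sub>C x) \<odot> a = c *\<^sub>C (x \<odot> a)"
    and act_scaleC_right: "x \<odot> (c *\<^sub>C a) = c *\<^sub>C (x \<odot> a)"
    and ip_add_right: "ip x (y + z) = ip x y + ip x z"
    and ip_scaleC_right: "ip x (c *\<^sub>C y) = c *\<^sub>C ip x y"
    and ip_act_right: "ip x (y \<odot> a) = ip x y * a"
    and star_ip: "star (ip x y) = ip y x"
    and ip_positive: "cstar_positive (ip x x)"
    and ip_definite: "ip x x = 0 \<Longrightarrow> x = 0"
    and norm_eq_ip: "norm x = sqrt (norm (ip x x))"
begin

subsection \<open>The C*-algebra of adjointable operators\<close>

definition adjointable :: "('h \<Rightarrow> 'h) \<Rightarrow> bool"
  where "adjointable T \<longleftrightarrow> (\<exists>S. \<forall>x y. ip (T x) y = ip x (S y))"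

definition adj :: "('h \<Rightarrow> 'h) \<Rightarrow> 'h \<Rightarrow> 'h"
  where "adj T = (THE S. \<forall>x y. ip (T x) y = ip x (S y))"

definition op_positive :: "('h \<Rightarrow> 'h) \<Rightarrow> bool"
  where "op_positive S \<longleftrightarrow> (\<exists>R. adjointable R \<and> S = adj R \<circ> R)"

text \<open>\<open>op_abs T\<close> is \<open>|T|\<close>, the positive square root of \<open>T\<^sup>*T\<close>.\<close>

definition op_abs :: "('h \<Rightarrow> 'h) \<Rightarrow> 'h \<Rightarrow> 'h"
  where "op_abs T = (THE S. op_positive S \<and> S \<circ> S = adj T \<circ> T)"

definition is_projection :: "('h \<Rightarrow> 'h) \<Rightarrow> bool"
  where "is_projection P \<longleftrightarrow> adjointable P \<and> adj P = P \<and> P \<circ> P = P"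

definition partial_isometry :: "('h \<Rightarrow> 'h) \<Rightarrow> bool"
  where "partial_isometry W \<longleftrightarrow> adjointable W \<and> is_projection (adj W \<circ> W)"


subsection \<open>Orthogonally complemented submodules\<close>

definition submodule :: "'h set \<Rightarrow> bool"
  where "submodule M \<longleftrightarrow> 0 \<in> M \<and> (\<forall>x\<in>M. \<forall>y\<in>M. x + y \<in> M) \<and>
    (\<forall>c. \<forall>x\<in>M. c *\<^sub>C x \<in> M) \<and> (\<forall>a. \<forall>x\<in>M. x \<odot> a \<in> M)"

definition ortho_complement :: "'h set \<Rightarrow> 'h set"
  where "ortho_complement M = {y. \<forall>x\<in>M. ip x y = 0}"

text \<open>The sum of \<open>M\<close> and its orthogonal complement is always direct.\<close>

definition ortho_complemented :: "'h set \<Rightarrow> bool"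
  where "ortho_complemented M \<longleftrightarrow> submodule M \<and> closed M \<and>
    (\<forall>x. \<exists>y\<in>M. \<exists>z\<in>ortho_complement M. x = y + z)"

definition proj_onto :: "'h set \<Rightarrow> 'h \<Rightarrow> 'h"
  where "proj_onto M x = (THE y. y \<in> M \<and> x - y \<in> ortho_complement M)"


subsection \<open>Polar decomposition, n-centered operators, Moore-Penrose inverse\<close>

text \<open>\<open>polar_decomp T U\<close>: the equation \<open>T = U|T|\<close> is the polar decomposition of \<open>T\<close>.\<close>

definition polar_decomp :: "('h \<Rightarrow> 'h) \<Rightarrow> ('h \<Rightarrow> 'h) \<Rightarrow> bool"
  where "polar_decomp T U \<longleftrightarrow> partial_isometry U \<and> T = U \<circ> op_abs T \<and>
    ortho_complemented (closure (range (adj T))) \<and>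
    adj U \<circ> U = proj_onto (closure (range (adj T)))"

definition n_centered :: "nat \<Rightarrow> ('h \<Rightarrow> 'h) \<Rightarrow> bool"
  where "n_centered n T \<longleftrightarrow>
    (\<exists>U. polar_decomp T U \<and> (\<forall>k\<in>{1..n}. polar_decomp (T ^^ k) (U ^^ k)))"

definition is_MP_inverse :: "('h \<Rightarrow> 'h) \<Rightarrow> ('h \<Rightarrow> 'h) \<Rightarrow> bool"
  where "is_MP_inverse T X \<longleftrightarrow> adjointable X \<and> T \<circ> X \<circ> T = T \<and> X \<circ> T \<circ> X = X \<and>
    adj (T \<circ> X) = T \<circ> X \<and> adj (X \<circ> T) = X \<circ> T"

definition MP_invertible :: "('h \<Rightarrow> 'h) \<Rightarrow> bool"
  where "MP_invertible T \<longleftrightarrow> (\<exists>X. is_MP_inverse T X)"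

definition MP_inverse :: "('h \<Rightarrow> 'h) \<Rightarrow> 'h \<Rightarrow> 'h"
  where "MP_inverse T = (THE X. is_MP_inverse T X)"

end

end

theory Submission
  imports Defs
begin

text \<open>
  Write \<open>X\<close> for the Moore-Penrose inverse of \<open>T\<close>. The theorem follows from two facts.

  First, taking Moore-Penrose inverses turns a polar decomposition into its adjoint: if \<open>A = V|A|\<close> is
  the polar decomposition of \<open>A\<close> and \<open>Y\<close> is the Moore-Penrose inverse of \<open>A\<close>, then \<open>|Y| = VY\<close>, and
  \<open>Y = V\<^sup>*|Y|\<close> is the polar decomposition of \<open>Y\<close> (lemma \<open>polar_mp\<close>).

  Second, if \<open>T\<close> is \<open>n\<close>-centered then \<open>X\<^sup>k\<close> is the Moore-Penrose inverse of \<open>T\<^sup>k\<close> for \<open>1 \<le> k \<le> n\<close>.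
  This goes by induction: when \<open>A = U|A|\<close>, \<open>B = V|B|\<close> and \<open>AB = UV|AB|\<close> are all polar decompositions,
  the operators \<open>A\<^sup>*A\<close> and \<open>BB\<^sup>*\<close> commute (lemma \<open>polar_mult_commute\<close>), and this commutation
  gives the reverse order law for the Moore-Penrose inverse of \<open>AB\<close> (lemma \<open>mp_mult\<close>). Applied to
  \<open>A = T\<close> and \<open>B = T\<^sup>k\<close> it yields the inductive step.

  Together: for a polar decomposition \<open>T\<^sup>k = U\<^sup>k|T\<^sup>k|\<close>, the polar decomposition of \<open>X\<^sup>k\<close> is
  \<open>X\<^sup>k = (U\<^sup>*)\<^sup>k|X\<^sup>k|\<close>. So \<open>X\<close> is \<open>n\<close>-centered whenever \<open>T\<close> is, and the converse is the same
  statement for \<open>X\<close>, because \<open>T\<close> is the Moore-Penrose inverse of \<open>X\<close>.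

  All this is algebra in the C*-algebra of adjointable operators, once it is known that \<open>T\<^sup>*T\<close> has
  exactly one positive square root. That is the analytic part. It is developed without spectra, for an
  abstract unital C*-algebra given as a closed subalgebra of a real Banach algebra: square roots come
  from an iteration, and a self-adjoint element \<open>a\<close> is called positive when \<open>t1 - a\<close> has norm at most
  \<open>t\<close> for some \<open>t \<ge> 0\<close>. The adjointable operators satisfy the C*-identity only by the
  Cauchy-Schwarz inequality, which in turn needs positivity in the coefficient algebra. Therefore the
  abstract theory is used twice. The coefficient algebra is a Hilbert module over itself, for which
  the Cauchy-Schwarz inequality is just submultiplicativity of the norm; positivity of multiplication
  operators there proves the inequality for every Hilbert module, and then the theory applies to the
  adjointable operators on the given module.
\<close>

section \<open>Square roots by iteration\<close>

lemma norm_self_mult_diff: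
  fixes u v :: "'e::real_normed_algebra"
  shows "norm (u * u - v * v) \<le> norm (u - v) * (norm u + norm v)"
proof -
  have "u * u - v * v = (u - v) * u + v * (u - v)" by (simp add: algebra_simps)
  then have "norm (u * u - v * v) \<le> norm ((u - v) * u) + norm (v * (u - v))"
    by (metis norm_triangle_ineq)
  also have "\<dots> \<le> norm (u - v) * norm u + norm v * norm (u - v)"
    by (intro add_mono norm_mult_ineq)
  finally show ?thesis by (simp add: algebra_simps)
qed

text \<open>
  The element \<open>y\<close> is \<open>1 - sqrt (1 - Z)\<close>, written without a unit. It is the limit of the iteration
  \<open>g (k+1) = (Z + g k * g k) / 2\<close>. The scalar iteration \<open>m\<close> for \<open>Z = 1\<close> increases and is bounded by \<open>1\<close>, and
  its increments dominate those of \<open>g\<close>, so \<open>g\<close> converges. The last property of \<open>y\<close> transfers to it whatever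
  is preserved along the iteration, such as self-adjointness or commuting with a given element.
\<close>

lemma exists_one_minus_sqrt:
  fixes Z :: "'e::{real_normed_algebra,banach}"
  assumes "norm Z \<le> 1"
  obtains y where "norm y \<le> 1" "y + y = Z + y * y"
    "\<And>S. closed S \<Longrightarrow> 0 \<in> S \<Longrightarrow> (\<And>w. w \<in> S \<Longrightarrow> (1/2) *\<^sub>R (Z + w * w) \<in> S) \<Longrightarrow> y \<in> S"
proof -
  define g where "g = rec_nat (0::'e) (\<lambda>_ w. (1/2) *\<^sub>R (Z + w * w))"
  define m where "m = rec_nat (0::real) (\<lambda>_ w. (1 + w * w) / 2)"
  have g0: "g 0 = 0" and gS: "\<And>k. g (Suc k) = (1/2) *\<^sub>R (Z + g k * g k)"
    by (simp_all add: g_def)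
  have m0: "m 0 = 0" and mS: "\<And>k. m (Suc k) = (1 + m k * m k) / 2"
    by (simp_all add: m_def)
  have m01: "0 \<le> m k \<and> m k \<le> 1" for k
  proof (induction k)
    case (Suc k)
    then have "m k * m k \<le> 1" by (simp add: mult_le_one)
    with Suc show ?case by (simp add: mS)
  qed (simp add: m0)
  have inc: "m k \<le> m (Suc k)" for k
    using zero_le_square[of "m k - 1"] by (simp add: mS algebra_simps)
  have dom: "norm (g k) \<le> m k \<and> norm (g (Suc k) - g k) \<le> m (Suc k) - m k" for k
  proof (induction k)
    case 0
    then show ?case using assms by (simp add: g0 gS m0 mS)
  next
    case (Suc k)
    have "norm (g (Suc k)) \<le> norm (g k) + norm (g (Suc k) - g k)"
      by (metis add.commute diff_add_cancel norm_triangle_ineq)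
    then have a: "norm (g (Suc k)) \<le> m (Suc k)" using Suc by linarith
    have "g (Suc (Suc k)) - g (Suc k) = (1/2) *\<^sub>R (g (Suc k) * g (Suc k) - g k * g k)"
      by (simp add: gS algebra_simps)
    then have "norm (g (Suc (Suc k)) - g (Suc k))
        \<le> (1/2) * (norm (g (Suc k) - g k) * (norm (g (Suc k)) + norm (g k)))"
      using norm_self_mult_diff[of "g (Suc k)" "g k"] by simp
    also have "\<dots> \<le> (1/2) * ((m (Suc k) - m k) * (m (Suc k) + m k))"
      using Suc a by (intro mult_left_mono mult_mono add_mono) (use m01[of k] m01[of "Suc k"] inc in auto)
    also have "\<dots> = (m (Suc k) * m (Suc k) - m k * m k) / 2" by (simp add: algebra_simps)
    also have "\<dots> = m (Suc (Suc k)) - m (Suc k)"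
      unfolding mS[of "Suc k"] by (simp add: mS[of k] field_simps)
    finally show ?case using a by blast
  qed
  have inc: "incseq m"
    by (rule incseq_SucI) (rule inc)
  have "convergent m"
    by (rule Bseq_mono_convergent[OF BseqI'[of _ 1]]) (use m01 inc in \<open>auto simp: incseq_def\<close>)
  then have "summable (\<lambda>k. m (Suc k) - m k)"
    by (auto simp: convergent_def dest: telescope_summable)
  then have "summable (\<lambda>k. norm (g (Suc k) - g k))"
    by (rule summable_comparison_test') (use dom in auto)
  then have "summable (\<lambda>k. g (Suc k) - g k)"
    by (rule summable_norm_cancel)
  then have "convergent (\<lambda>k. \<Sum>i<k. g (Suc i) - g i)"
    by (simp add: summable_iff_convergent)
  then have "convergent g"
    by (simp add: sum_lessThan_telescope g0)
  then obtain y where y: "g \<longlonglongrightarrow> y" by (auto simp: convergent_def)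
  have "norm y \<le> 1"
    by (rule LIMSEQ_le_const2[OF tendsto_norm[OF y]]) (use dom m01 order_trans in blast)
  moreover have "y + y = Z + y * y"
  proof -
    have "(\<lambda>k. g (Suc k)) \<longlonglongrightarrow> (1/2) *\<^sub>R (Z + y * y)"
      unfolding gS by (intro tendsto_intros y)
    then have "y = (1/2) *\<^sub>R (Z + y * y)"
      using LIMSEQ_Suc[OF y] LIMSEQ_unique by blast
    then have "2 *\<^sub>R y = Z + y * y"
      by (metis scaleR_half_double scaleR_2 scaleR_right_distrib)
    then show ?thesis by (simp add: scaleR_2)
  qed
  moreover have "y \<in> S" if "closed S" "0 \<in> S" "\<And>w. w \<in> S \<Longrightarrow> (1/2) *\<^sub>R (Z + w * w) \<in> S" for S
  proof -
    have "g k \<in> S" for k by (induction k) (auto simp: g0 gS that)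
    then show ?thesis using closed_sequentially \<open>closed S\<close> y by blast
  qed
  ultimately show ?thesis using that by blast
qed

section \<open>Positivity in a unital C*-algebra\<close>

text \<open>
  The C*-algebra is a closed subset \<open>B\<close> of a ring type and not the whole type, so that the operators with
  an adjoint form an instance inside the algebra of all bounded operators. The complex structure enters
  only through the imaginary unit \<open>J\<close>. The zero algebra is included, so \<open>1\<close> may have norm \<open>0\<close>.
\<close>

locale unital_cstar =
  fixes B :: "'e::{real_normed_algebra,monoid_mult,banach} set"
    and st :: "'e \<Rightarrow> 'e" and J :: 'e
  assumes closed_B: "closed B"
    and one_B [simp]: "1 \<in> B"
    and J_B [simp]: "J \<in> B"
    and add_B [simp]: "x \<in> B \<Longrightarrow> y \<in> B \<Longrightarrow> x + y \<in> B"
    and scaleR_B [simp]: "x \<in> B \<Longrightarrow> r *\<^sub>R x \<in> B"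
    and mult_B [simp]: "x \<in> B \<Longrightarrow> y \<in> B \<Longrightarrow> x * y \<in> B"
    and st_B [simp]: "x \<in> B \<Longrightarrow> st x \<in> B"
    and st_add [simp]: "x \<in> B \<Longrightarrow> y \<in> B \<Longrightarrow> st (x + y) = st x + st y"
    and st_scaleR [simp]: "x \<in> B \<Longrightarrow> st (r *\<^sub>R x) = r *\<^sub>R st x"
    and st_mult [simp]: "x \<in> B \<Longrightarrow> y \<in> B \<Longrightarrow> st (x * y) = st y * st x"
    and st_st [simp]: "x \<in> B \<Longrightarrow> st (st x) = x"
    and norm_cstar: "x \<in> B \<Longrightarrow> norm (st x * x) = (norm x)\<^sup>2"
    and J_J: "J * J = - 1"
    and J_central: "x \<in> B \<Longrightarrow> J * x = x * J"
    and st_J [simp]: "st J = - J"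
begin

lemma zero_B [simp]: "0 \<in> B"
  using scaleR_B[OF one_B, of 0] by simp

lemma minus_B [simp]: "x \<in> B \<Longrightarrow> - x \<in> B"
  using scaleR_B[of x "-1"] by simp

lemma diff_B [simp]: "x \<in> B \<Longrightarrow> y \<in> B \<Longrightarrow> x - y \<in> B"
  using add_B[of x "- y"] by simp

lemma st_zero [simp]: "st 0 = 0"
  using st_scaleR[OF one_B, of 0] by simp

lemma st_minus [simp]: "x \<in> B \<Longrightarrow> st (- x) = - st x"
  using st_scaleR[of x "-1"] by simp

lemma st_diff [simp]: "x \<in> B \<Longrightarrow> y \<in> B \<Longrightarrow> st (x - y) = st x - st y"
  using st_add[of x "- y"] by simp

lemma st_one [simp]: "st 1 = 1"
  by (metis mult_1_right mult_1_left one_B st_B st_mult st_st)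

lemma norm_st [simp]:
  assumes "x \<in> B" shows "norm (st x) = norm x"
proof -
  have "norm x \<le> norm (st x)" if "x \<in> B" for x
  proof (cases "norm x = 0")
    case False
    have "norm x * norm x \<le> norm (st x) * norm x"
      using norm_cstar[OF that] norm_mult_ineq[of "st x" x] by (simp add: power2_eq_square)
    then show ?thesis using False by (simp add: mult_le_cancel_right)
  qed auto
  from this[OF assms] this[of "st x"] show ?thesis using assms by simp
qed

lemma st_self_mult_eq_0: "x \<in> B \<Longrightarrow> st x * x = 0 \<Longrightarrow> x = 0"
  using norm_cstar[of x] by simp

lemma norm_one_le: "norm (1::'e) \<le> 1"
proof (cases "norm (1::'e) = 0")
  case False
  have "norm (1::'e) = norm (1::'e) * norm (1::'e)"
    using norm_cstar[OF one_B] by (simp add: power2_eq_square)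
  with False show ?thesis by simp
qed auto

definition sa :: "'e \<Rightarrow> bool" where "sa x \<longleftrightarrow> x \<in> B \<and> st x = x"

lemma saD [dest]: "sa x \<Longrightarrow> x \<in> B" "sa x \<Longrightarrow> st x = x"
  by (auto simp: sa_def)

lemma sa_intros:
  "sa 0" "sa 1" "sa x \<Longrightarrow> sa y \<Longrightarrow> sa (x + y)" "sa x \<Longrightarrow> sa y \<Longrightarrow> sa (x - y)"
  "sa x \<Longrightarrow> sa (- x)" "sa x \<Longrightarrow> sa (r *\<^sub>R x)"
  "sa x \<Longrightarrow> sa (x * x)" "x \<in> B \<Longrightarrow> sa (st x * x)" "x \<in> B \<Longrightarrow> sa (x * st x)"
  by (auto simp: sa_def)

lemma sa_mult: "sa x \<Longrightarrow> sa y \<Longrightarrow> x * y = y * x \<Longrightarrow> sa (x * y)"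
  by (auto simp: sa_def)

lemma norm_sa_square: "sa x \<Longrightarrow> norm (x * x) = (norm x)\<^sup>2"
  using norm_cstar[of x] by (auto simp: sa_def)

lemma closed_sa: "closed {x. sa x}"
  unfolding closed_sequential_limits
proof (intro allI impI, elim conjE)
  fix f x assume f: "\<forall>n::nat. f n \<in> {x. sa x}" and lim: "f \<longlonglongrightarrow> x"
  have x: "x \<in> B" using closed_sequentially[OF closed_B _ lim] f by auto
  have "norm (st x - x) \<le> 2 * norm (f n - x)" for n
  proof -
    have "st x - x = (f n - x) - st (f n - x)" using f x by (auto simp: sa_def)
    then have "norm (st x - x) \<le> norm (f n - x) + norm (st (f n - x))"
      by (metis norm_triangle_ineq4)
    moreover have "f n - x \<in> B" using f x by (auto simp: sa_def)
    ultimately show ?thesis by simp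
  qed
  moreover have "(\<lambda>n. 2 * norm (f n - x)) \<longlonglongrightarrow> 2 * norm (x - x)"
    by (intro tendsto_intros lim)
  ultimately have "norm (st x - x) \<le> 2 * norm (x - x)"
    using LIMSEQ_le_const by blast
  then show "x \<in> {x. sa x}" using x by (simp add: sa_def)
qed

text \<open>
  For self-adjoint \<open>a\<close> the norm condition says that the spectrum of \<open>a\<close> lies in \<open>[0, 2t]\<close>. In this form
  it is visibly stable under sums, and for \<open>t > 0\<close> it presents \<open>a/t\<close> as \<open>1 - z\<close> with \<open>z\<close> of norm at most \<open>1\<close>,
  to which the iteration for square roots applies.
\<close>

definition pos :: "'e \<Rightarrow> bool"
  where "pos a \<longleftrightarrow> sa a \<and> (\<exists>t\<ge>0. norm (t *\<^sub>R 1 - a) \<le> t)"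

lemma pos_sa: "pos a \<Longrightarrow> sa a"
  by (simp add: pos_def)

lemma pos_0 [simp]: "pos 0"
  unfolding pos_def by (auto intro!: sa_intros exI[of _ 0])

lemma pos_add: assumes "pos a" "pos b" shows "pos (a + b)"
proof -
  obtain s t where st: "s \<ge> 0" "t \<ge> 0" "norm (s *\<^sub>R 1 - a) \<le> s" "norm (t *\<^sub>R 1 - b) \<le> t"
    using assms unfolding pos_def by blast
  have "(s + t) *\<^sub>R 1 - (a + b) = (s *\<^sub>R 1 - a) + (t *\<^sub>R 1 - b)" by (simp add: algebra_simps)
  then have "norm ((s + t) *\<^sub>R 1 - (a + b)) \<le> norm (s *\<^sub>R 1 - a) + norm (t *\<^sub>R 1 - b)"
    by (metis norm_triangle_ineq)
  then have "norm ((s + t) *\<^sub>R 1 - (a + b)) \<le> s + t"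
    using st by linarith
  then show ?thesis using assms st unfolding pos_def
    by (auto intro!: sa_intros exI[of _ "s + t"])
qed

lemma pos_scaleR: assumes "pos a" "c \<ge> 0" shows "pos (c *\<^sub>R a)"
proof -
  obtain t where t: "t \<ge> 0" "norm (t *\<^sub>R 1 - a) \<le> t"
    using assms unfolding pos_def by blast
  have "norm ((c * t) *\<^sub>R 1 - c *\<^sub>R a) = c * norm (t *\<^sub>R 1 - a)"
    using assms(2) by (simp flip: scaleR_scaleR scaleR_diff_right)
  then show ?thesis using assms t unfolding pos_def
    by (auto intro!: sa_intros exI[of _ "c * t"] mult_left_mono)
qed

lemma sqrt_one_minus:
  assumes "sa z" "norm z \<le> 1"
  obtains r where "pos r" "r * r = 1 - z" "\<And>w. w * z = z * w \<Longrightarrow> w * r = r * w"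
proof -
  obtain y where y: "norm y \<le> 1" "y + y = z + y * y"
    "\<And>S. closed S \<Longrightarrow> 0 \<in> S \<Longrightarrow> (\<And>w. w \<in> S \<Longrightarrow> (1/2) *\<^sub>R (z + w * w) \<in> S) \<Longrightarrow> y \<in> S"
    using exists_one_minus_sqrt[OF assms(2)] by metis
  have "y \<in> {x. sa x}"
    by (rule y(3)[OF closed_sa]) (use assms(1) in \<open>auto intro!: sa_intros\<close>)
  then have say: "sa y" by simp
  have comm: "w * y = y * w" if "w * z = z * w" for w
  proof -
    have "y \<in> {x. w * x = x * w}"
    proof (rule y(3))
      show "closed {x. w * x = x * w}" by (intro closed_Collect_eq continuous_intros)
      fix v assume "v \<in> {x. w * x = x * w}"
      then have v: "w * v = v * w" by simp
      have "w * (v * v) = v * w * v" by (simp add: v flip: mult.assoc)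
      also have "\<dots> = v * v * w" by (simp add: v mult.assoc)
      finally have "w * (v * v) = (v * v) * w" .
      with that have "w * (z + v * v) = (z + v * v) * w"
        by (simp only: distrib_left distrib_right)
      then show "(1/2) *\<^sub>R (z + v * v) \<in> {x. w * x = x * w}" by simp
    qed simp
    then show ?thesis by simp
  qed
  have "pos (1 - y)"
    unfolding pos_def using say y(1) by (auto intro!: sa_intros exI[of _ 1])
  moreover have "(1 - y) * (1 - y) = 1 - z"
  proof -
    have "z = y + y - y * y" using y(2) by (simp add: algebra_simps)
    then show ?thesis by (simp add: algebra_simps)
  qed
  moreover have "w * (1 - y) = (1 - y) * w" if "w * z = z * w" for w
    using comm[OF that] by (simp add: left_diff_distrib right_diff_distrib)
  ultimately show ?thesis using that by blast
qed

lemma sqrt_scaled: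
  assumes "sa z" "norm z \<le> t" "t > 0"
  obtains r where "pos r" "r * r = t *\<^sub>R 1 - z" "\<And>w. w * z = z * w \<Longrightarrow> w * r = r * w"
proof -
  \<comment> \<open>Rescaling to \<open>t = 1\<close>.\<close>
  define z' where "z' = (1 / t) *\<^sub>R z"
  have "sa z'" "norm z' \<le> 1" using assms by (auto simp: z'_def divide_simps intro!: sa_intros)
  then obtain r where r: "pos r" "r * r = 1 - z'" "\<And>w. w * z' = z' * w \<Longrightarrow> w * r = r * w"
    using sqrt_one_minus by metis
  have "pos (sqrt t *\<^sub>R r)" using r(1) assms(3) by (simp add: pos_scaleR)
  moreover have "(sqrt t *\<^sub>R r) * (sqrt t *\<^sub>R r) = t *\<^sub>R 1 - z"
    using assms(3) r(2) by (simp add: z'_def scaleR_diff_right)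
  moreover have "w * (sqrt t *\<^sub>R r) = (sqrt t *\<^sub>R r) * w" if "w * z = z * w" for w
    using r(3)[of w] that by (simp add: z'_def)
  ultimately show ?thesis using that by blast
qed

text \<open>
  The root commutes with everything that commutes with \<open>a\<close>. This replaces the continuous functional
  calculus in all that follows.
\<close>

lemma pos_sqrt:
  assumes "pos a"
  obtains r where "pos r" "r * r = a" "\<And>w. w * a = a * w \<Longrightarrow> w * r = r * w"
proof -
  obtain t where t: "t \<ge> 0" "norm (t *\<^sub>R 1 - a) \<le> t" and "sa a"
    using assms unfolding pos_def by blast
  show ?thesis
  proof (cases "t = 0")
    case True
    then have "a = 0" using t by simp
    then show ?thesis using that[of 0] by simp
  next
    case False
    have "sa (t *\<^sub>R 1 - a)" using \<open>sa a\<close> by (auto intro!: sa_intros)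
    then obtain r where r: "pos r" "r * r = t *\<^sub>R 1 - (t *\<^sub>R 1 - a)"
        "\<And>w. w * (t *\<^sub>R 1 - a) = (t *\<^sub>R 1 - a) * w \<Longrightarrow> w * r = r * w"
      using sqrt_scaled[of "t *\<^sub>R 1 - a" t] t False by (metis antisym_conv2)
    have "w * r = r * w" if "w * a = a * w" for w
      by (rule r(3)) (simp add: left_diff_distrib right_diff_distrib that)
    moreover have "r * r = a" using r(2) by simp
    ultimately show ?thesis using that[OF r(1)] by blast
  qed
qed

text \<open>
  Commuting self-adjoint \<open>r\<close>, \<open>s\<close> are the real and imaginary parts of a normal element \<open>N\<close>, whose norm is
  controlled by \<open>r\<^sup>2 + s\<^sup>2\<close>. For \<open>r\<^sup>2 + s\<^sup>2 = 1\<close> it is the unitary with real part \<open>r\<close>.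
\<close>

lemma cartesian_decomposition:
  assumes "sa r" "sa s" "r * s = s * r"
  defines "N \<equiv> r + J * s"
  shows "N \<in> B" "st N = r - J * s" "st N * N = r * r + s * s" "norm r \<le> norm N"
    "N * N + st N * st N = 2 *\<^sub>R (r * r - s * s)"
proof -
  have rs: "r \<in> B" "s \<in> B" "st r = r" "st s = s" using assms by auto
  have c: "r * J = J * r" "s * J = J * s" using J_central rs by auto
  have JJ: "J * (J * x) = - x" for x by (simp add: J_J flip: mult.assoc)
  have c': "s * (J * x) = J * (s * x)" "r * (J * x) = J * (r * x)" for x
    by (metis c mult.assoc)+
  show NB: "N \<in> B" using rs by (simp add: N_def)
  show stN: "st N = r - J * s" using rs c by (simp add: N_def)
  show "st N * N = r * r + s * s"
    unfolding stN unfolding N_def using assms(3) by (simp add: algebra_simps JJ J_J c' c)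
  show "N * N + st N * st N = 2 *\<^sub>R (r * r - s * s)"
    unfolding stN unfolding N_def using assms(3) by (simp add: algebra_simps JJ J_J c' c scaleR_2)
  have "2 *\<^sub>R r = N + st N" unfolding stN unfolding N_def by (simp add: scaleR_2)
  then have "2 * norm r \<le> norm N + norm (st N)"
    by (metis norm_scaleR norm_triangle_ineq abs_numeral)
  then show "norm r \<le> norm N" using NB by simp
qed

lemma norm_scaled_one_le: "t \<ge> 0 \<Longrightarrow> norm (t *\<^sub>R 1 :: 'e) \<le> t"
  using norm_one_le by (simp add: mult_left_le)

text \<open>
  Choose \<open>s\<close> with \<open>r\<^sup>2 + s\<^sup>2 = t\<close>, so that \<open>N = r + Js\<close> is \<open>sqrt t\<close> times a unitary. As \<open>N\<^sup>2 + (N\<^sup>*)\<^sup>2 = 2(r\<^sup>2 - s\<^sup>2)\<close>,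
  the element \<open>t - r\<^sup>2\<close> is \<open>t/2\<close> minus a quarter of a sum of two elements of norm at most \<open>t\<close>, and so has norm at most \<open>t\<close>.
\<close>

lemma pos_square:
  assumes "sa r"
  shows "pos (r * r)"
proof -
  \<comment> \<open>The summand \<open>1\<close> keeps \<open>t\<close> positive when \<open>r = 0\<close>.\<close>
  define t where "t = norm (r * r) + 1"
  have t: "t > 0" "norm (r * r) \<le> t" by (auto simp: t_def add_nonneg_pos)
  obtain s where s: "pos s" "s * s = t *\<^sub>R 1 - r * r"
      and comm: "\<And>w. w * (r * r) = r * r * w \<Longrightarrow> w * s = s * w"
    using sqrt_scaled[OF sa_intros(7)[OF assms] t(2,1)] by metis
  define N where "N = r + J * s"
  have "r * s = s * r" by (rule comm) (simp add: mult.assoc)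
  note N = cartesian_decomposition[OF assms(1) pos_sa[OF s(1)] this, folded N_def]
  have "st N * N = t *\<^sub>R 1" using N(3) s(2) by simp
  then have "(norm N)\<^sup>2 \<le> t"
    using norm_cstar[OF N(1)] norm_scaled_one_le[of t] t(1) by simp
  then have n: "norm N * norm N \<le> t" by (simp add: power2_eq_square)
  have "2 *\<^sub>R (r * r - s * s) = 4 *\<^sub>R (r * r) - (2 * t) *\<^sub>R 1"
  proof -
    have "4 *\<^sub>R x = 2 *\<^sub>R x + 2 *\<^sub>R x" for x :: 'e by (simp flip: scaleR_add_left)
    then show ?thesis unfolding s(2) by (simp add: algebra_simps)
  qed
  then have "4 *\<^sub>R (t *\<^sub>R 1 - r * r) = (2 * t) *\<^sub>R 1 - (N * N + st N * st N)"
  proof -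
    have "4 *\<^sub>R (t *\<^sub>R 1 - r * r) = (2 * t) *\<^sub>R 1 + (2 * t) *\<^sub>R 1 - 4 *\<^sub>R (r * r)"
      by (simp add: scaleR_right_diff_distrib flip: scaleR_add_left)
    also have "\<dots> = (2 * t) *\<^sub>R 1 - (4 *\<^sub>R (r * r) - (2 * t) *\<^sub>R 1)" by simp
    finally show ?thesis using \<open>2 *\<^sub>R (r * r - s * s) = _\<close> unfolding N(5) by simp
  qed
  then have "4 * norm (t *\<^sub>R 1 - r * r) \<le> norm ((2 * t) *\<^sub>R 1 :: 'e) + norm (N * N + st N * st N)"
    by (metis norm_scaleR norm_triangle_ineq4 abs_numeral)
  also have "\<dots> \<le> 2 * t + (norm (N * N) + norm (st N * st N))"
    using t by (intro add_mono norm_scaled_one_le norm_triangle_ineq) auto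
  also have "\<dots> \<le> 2 * t + (norm N * norm N + norm (st N) * norm (st N))"
    by (intro add_mono norm_mult_ineq order_refl)
  also have "\<dots> \<le> 4 * t" using n N(1) by simp
  finally show ?thesis unfolding pos_def using t assms
    by (auto intro!: sa_intros exI[of _ t])
qed

text \<open>
  With \<open>a = r\<^sup>2\<close> and \<open>-a = s\<^sup>2\<close> the normal element \<open>r + Js\<close> satisfies \<open>N\<^sup>*N = r\<^sup>2 + s\<^sup>2 = 0\<close>.
\<close>

lemma pos_antisym:
  assumes "pos a" "pos (- a)"
  shows "a = 0"
proof -
  obtain r where r: "pos r" "r * r = a" using pos_sqrt[OF assms(1)] by metis
  obtain s where s: "pos s" "s * s = - a" and comm: "\<And>w. w * - a = - a * w \<Longrightarrow> w * s = s * w"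
    using pos_sqrt[OF assms(2)] by metis
  have "r * s = s * r" by (rule comm) (simp add: mult.assoc flip: r(2))
  note N = cartesian_decomposition[OF pos_sa[OF r(1)] pos_sa[OF s(1)] this]
  have "r + J * s = 0" using st_self_mult_eq_0[OF N(1)] N(3) r s by simp
  then show ?thesis using N(4) r by simp
qed

text \<open>
  For \<open>t\<close> the norm of \<open>b\<close>, both \<open>a\<close> and \<open>t - a\<close> are positive. If \<open>r\<close> and \<open>s\<close> are their roots, then
  \<open>(r + Js)\<^sup>*(r + Js) = t\<close> bounds \<open>r\<close>.
\<close>

lemma norm_le_of_pos_diff:
  assumes "pos a" "pos (b - a)"
  shows "norm a \<le> norm b"
proof -
  define t where "t = norm b"
  have "sa b" using sa_intros(3)[OF pos_sa[OF assms(2)] pos_sa[OF assms(1)]] by simp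
  then have "pos (t *\<^sub>R 1 - b)" unfolding pos_def
    by (auto simp: t_def intro!: sa_intros exI[of _ t])
  from pos_add[OF this assms(2)] have "pos (t *\<^sub>R 1 - a)" by simp
  then obtain s where s: "pos s" "s * s = t *\<^sub>R 1 - a"
      and comm: "\<And>w. w * (t *\<^sub>R 1 - a) = (t *\<^sub>R 1 - a) * w \<Longrightarrow> w * s = s * w"
    using pos_sqrt by metis
  obtain r where r: "pos r" "r * r = a" using pos_sqrt[OF assms(1)] by metis
  have "r * s = s * r" by (rule comm) (simp add: algebra_simps flip: r(2))
  note N = cartesian_decomposition[OF pos_sa[OF r(1)] pos_sa[OF s(1)] this]
  have "norm a = (norm r)\<^sup>2" using norm_sa_square[OF pos_sa[OF r(1)]] r by simp
  also have "\<dots> \<le> (norm (r + J * s))\<^sup>2" using N(4) by (intro power_mono) auto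
  also have "\<dots> = norm (t *\<^sub>R 1 :: 'e)" using norm_cstar[OF N(1)] N(3) r s by simp
  also have "\<dots> \<le> t" by (rule norm_scaled_one_le) (simp add: t_def)
  finally show ?thesis by (simp add: t_def)
qed

lemma norm_sa_power:
  assumes "sa c"
  shows "sa (c ^ (2 ^ k)) \<and> norm (c ^ (2 ^ k)) = norm c ^ (2 ^ k)"
proof (induction k)
  case (Suc k)
  have "c ^ (2 ^ Suc k) = c ^ (2 ^ k) * c ^ (2 ^ k)"
    by (simp add: mult_2 flip: power_add)
  moreover have "norm c ^ (2 ^ Suc k) = (norm c ^ (2 ^ k))\<^sup>2"
    by (simp add: mult.commute flip: power_mult)
  ultimately show ?case using Suc norm_sa_square sa_intros(7) by metis
qed (use assms in auto)

text \<open>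
  This replaces the coincidence of the nonzero spectra of \<open>y\<^sup>*y\<close> and \<open>yy\<^sup>*\<close>. The power \<open>(1 + yy\<^sup>*)\<^sup>n\<close> equals
  \<open>1 + y q y\<^sup>*\<close> with \<open>q\<close> the sum of the first \<open>n\<close> powers of \<open>1 + y\<^sup>*y\<close>, so its norm grows at most linearly in \<open>n\<close>.
  For \<open>n\<close> a power of \<open>2\<close> this norm is the \<open>n\<close>-th power of the norm of the self-adjoint \<open>1 + yy\<^sup>*\<close>, which therefore
  is at most \<open>1\<close>.
\<close>

lemma norm_one_plus_swap:
  assumes y: "y \<in> B" and le: "norm (1 + st y * y) \<le> 1"
  shows "norm (1 + y * st y) \<le> 1"
proof (rule ccontr)
  define b c where "b = 1 + st y * y" and "c = 1 + y * st y"
  define K where "K = norm y * norm (st y)"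
  assume "\<not> norm (1 + y * st y) \<le> 1"
  then have c1: "norm c > 1" by (simp add: c_def)
  have "\<exists>q. norm q \<le> real n \<and> c ^ n = 1 + y * q * st y" for n
  proof (induction n)
    case 0
    then show ?case by (auto intro: exI[of _ 0])
  next
    case (Suc n)
    then obtain q where q: "norm q \<le> real n" "c ^ n = 1 + y * q * st y" by blast
    have "norm (b * q) \<le> 1 * real n"
      by (rule order_trans[OF norm_mult_ineq mult_mono]) (use le q(1) in \<open>auto simp: b_def\<close>)
    then have "norm (1 + b * q) \<le> real (Suc n)"
      using norm_triangle_ineq[of 1 "b * q"] norm_one_le by simp
    moreover have "c ^ Suc n = 1 + y * (1 + b * q) * st y"
      by (simp add: q(2)) (simp add: b_def c_def algebra_simps)
    ultimately show ?case by blast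
  qed
  then have bound: "norm (c ^ n) \<le> 1 + real n * K" for n
  proof -
    obtain q where q: "norm q \<le> real n" "c ^ n = 1 + y * q * st y"
      using \<open>\<And>n. \<exists>q. norm q \<le> real n \<and> c ^ n = 1 + y * q * st y\<close> by blast
    have "norm (y * q * st y) \<le> norm y * norm q * norm (st y)"
      by (rule order_trans[OF norm_mult_ineq mult_right_mono[OF norm_mult_ineq norm_ge_zero]])
    also have "\<dots> \<le> norm y * real n * norm (st y)"
      using q(1) by (intro mult_mono) auto
    finally show ?thesis
      using q(2) norm_triangle_ineq[of 1 "y * q * st y"] norm_one_le by (simp add: K_def mult_ac)
  qed
  \<comment> \<open>If the norm of \<open>c\<close> exceeded \<open>1\<close>, then both \<open>x^n\<close> and \<open>n x^n\<close> would tend to \<open>0\<close>.\<close>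
  define x where "x = 1 / norm c"
  have "sa c" using y by (auto simp: c_def intro!: sa_intros)
  have ge: "1 \<le> x ^ (2 ^ k) + K * (real (2 ^ k) * x ^ (2 ^ k))" for k
  proof -
    have "norm c ^ (2 ^ k) \<le> 1 + real (2 ^ k) * K"
      using bound norm_sa_power[OF \<open>sa c\<close>] by metis
    then have "1 \<le> (1 + real (2 ^ k) * K) / norm c ^ (2 ^ k)"
      using c1 by (subst le_divide_eq_1_pos) (auto intro: zero_less_power order_less_trans[OF zero_less_one])
    then show ?thesis by (simp add: x_def power_one_over add_divide_distrib mult_ac)
  qed
  have "0 < norm c" using c1 by linarith
  then have nx: "norm x < 1" using c1 by (simp add: x_def)
  have "(\<lambda>n. x ^ n + K * (real n * x ^ n)) \<longlonglongrightarrow> 0 + K * 0"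
    by (intro tendsto_add tendsto_mult tendsto_const LIMSEQ_power_zero powser_times_n_limit_0 nx)
  from LIMSEQ_subseq_LIMSEQ[OF this, of "\<lambda>k. 2 ^ k"]
  have "(\<lambda>k. x ^ (2 ^ k) + K * (real (2 ^ k) * x ^ (2 ^ k))) \<longlonglongrightarrow> 0"
    by (simp add: o_def strict_mono_def)
  from LIMSEQ_le_const[OF this, of 1] ge show False by fastforce
qed

lemma neg_pos_swap:
  assumes x: "x \<in> B" and "pos (- (st x * x))"
  shows "pos (- (x * st x))"
proof -
  obtain t where t: "t \<ge> 0" "norm (t *\<^sub>R 1 - - (st x * x)) \<le> t"
    using assms(2) unfolding pos_def by blast
  show ?thesis
  proof (cases "t = 0")
    case True
    then have "st x * x = 0" using t by simp
    then show ?thesis using st_self_mult_eq_0[OF x] by simp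
  next
    case False
    define y where "y = (1 / sqrt t) *\<^sub>R x"
    have y: "y \<in> B" using x by (simp add: y_def)
    have "t *\<^sub>R (1 + st y * y) = t *\<^sub>R 1 - - (st x * x)"
      using t False x by (simp add: y_def scaleR_add_right)
    then have "norm (t *\<^sub>R (1 + st y * y)) \<le> t" using t(2) by simp
    then have "norm (1 + st y * y) \<le> 1" using t(1) False by (simp add: mult_le_cancel_left1)
    then have "norm (1 *\<^sub>R 1 - - (y * st y)) \<le> 1" using norm_one_plus_swap[OF y] by simp
    then have "pos (- (y * st y))"
      unfolding pos_def using y by (auto intro!: sa_intros exI[of _ 1])
    moreover have "- (x * st x) = t *\<^sub>R (- (y * st y))"
      using t False x by (simp add: y_def)
    ultimately show ?thesis using pos_scaleR t(1) by metis
  qed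
qed

lemma sa_square_eq_0: "sa x \<Longrightarrow> x * x = 0 \<Longrightarrow> x = 0"
  using norm_sa_square[of x] by simp

text \<open>
  Both \<open>-x\<^sup>*x\<close> and \<open>-xx\<^sup>*\<close> are positive, while \<open>2(x\<^sup>*x + xx\<^sup>*)\<close> is the sum of the squares of the self-adjoint
  elements \<open>p = x + x\<^sup>*\<close> and \<open>q = J(x - x\<^sup>*)\<close>. So both squares vanish.
\<close>

lemma neg_pos_eq_0:
  assumes x: "x \<in> B" and neg: "pos (- (st x * x))"
  shows "x = 0"
proof -
  define p q where "p = x + st x" and "q = J * (x - st x)"
  have sa: "sa p" "sa q"
    using x J_central[of "x - st x"] by (auto simp: p_def q_def sa_def algebra_simps)
  have qq: "q * q = - ((x - st x) * (x - st x))"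
  proof -
    define w where "w = x - st x"
    have "w * J = J * w" using J_central[of w] x by (simp add: w_def)
    then have "q * q = J * J * (w * w)"
      unfolding q_def w_def[symmetric] by (metis mult.assoc)
    then show ?thesis by (simp add: J_J flip: w_def)
  qed
  have s: "- (p * p + q * q) = 2 *\<^sub>R (- (st x * x) + - (x * st x))"
    unfolding qq p_def by (simp add: algebra_simps scaleR_2)
  have "pos (- (p * p + q * q))"
    unfolding s by (intro pos_scaleR pos_add neg neg_pos_swap x) auto
  moreover have pp: "pos (p * p)" "pos (q * q)" using pos_square sa by auto
  ultimately have "p * p + q * q = 0" using pos_antisym pos_add by blast
  then have "- (p * p) = q * q" "- (q * q) = p * p" by (simp_all add: add_eq_0_iff)
  then have "p * p = 0" "q * q = 0" using pp pos_antisym by metis+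
  then have "p = 0" "q = 0" using sa sa_square_eq_0 by auto
  have "J * q = - (x - st x)" by (simp add: q_def J_J flip: mult.assoc)
  then have "x - st x = 0" using \<open>q = 0\<close> by simp
  then have "2 *\<^sub>R x = 0" using \<open>p = 0\<close> by (simp add: p_def scaleR_2)
  then show ?thesis by simp
qed

lemma sa_cube_eq_0:
  assumes "sa d" "d * d * d = 0"
  shows "d = 0"
proof -
  have "(d * d) * (d * d) = 0" using assms(2) by (simp flip: mult.assoc)
  then show ?thesis using assms(1) sa_square_eq_0 sa_intros(7) by metis
qed

lemma pos_mult_square:
  assumes "pos m" "sa d" "d * m = m * d"
  shows "pos (m * (d * d))"
proof -
  obtain q where q: "pos q" "q * q = m" and comm: "\<And>w. w * m = m * w \<Longrightarrow> w * q = q * w"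
    using pos_sqrt[OF assms(1)] by metis
  have dq: "d * q = q * d" by (rule comm) fact
  have "sa (q * d)" using sa_mult[OF pos_sa[OF q(1)] assms(2)] dq by simp
  moreover have "(q * d) * (q * d) = m * (d * d)"
    by (metis dq mult.assoc q(2))
  ultimately show ?thesis using pos_square by metis
qed

text \<open>
  Let \<open>m\<close> be the absolute value of \<open>c = x\<^sup>*x\<close>. Then \<open>d = m - c\<close> is twice the negative part of \<open>c\<close>, and \<open>y = xd\<close>
  has \<open>y\<^sup>*y = dcd = - m d\<^sup>2\<close>, the negative of a positive element. So \<open>y = 0\<close>, which forces \<open>d = 0\<close>.
\<close>

lemma pos_st_mult:
  assumes x: "x \<in> B"
  shows "pos (st x * x)"
proof -
  define c where "c = st x * x"
  have c: "sa c" using x by (auto simp: c_def intro!: sa_intros)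
  obtain m where m: "pos m" "m * m = c * c"
      and comm: "\<And>w. w * (c * c) = c * c * w \<Longrightarrow> w * m = m * w"
    using pos_sqrt[OF pos_square[OF c]] by metis
  have cm: "c * m = m * c" by (rule comm) (simp add: mult.assoc)
  define d where "d = m - c"
  have d: "sa d" unfolding d_def by (intro sa_intros c pos_sa m(1))
  have dm: "d * m = m * d" using cm by (simp add: d_def algebra_simps)
  have cd: "c * d = - (m * d)" using cm m(2) by (simp add: d_def algebra_simps)
  have dd: "d * d = 2 *\<^sub>R (m * d)" using cm m(2) by (simp add: d_def algebra_simps scaleR_2)
  define y where "y = x * d"
  have y: "y \<in> B" using x d by (auto simp: y_def)
  have "st y * y = d * (c * d)"
    using x d by (simp add: y_def c_def mult.assoc saD)
  also have "\<dots> = - (m * (d * d))" unfolding cd using dm by (simp flip: mult.assoc)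
  finally have "- (st y * y) = m * (d * d)" by simp
  with pos_mult_square[OF m(1) d dm] neg_pos_eq_0[OF y] have "y = 0" by simp
  then have "m * (d * d) = 0" using \<open>- (st y * y) = m * (d * d)\<close> by simp
  moreover have "d * d * d = (2 *\<^sub>R (m * d)) * d" by (simp only: dd)
  ultimately have "d * d * d = 0" by (simp add: mult.assoc)
  then have "d = 0" using sa_cube_eq_0 d by blast
  then show ?thesis using m(1) by (simp add: d_def c_def)
qed

lemma pos_conj:
  assumes "pos a" "x \<in> B"
  shows "pos (st x * a * x)"
proof -
  obtain q where q: "pos q" "q * q = a" using pos_sqrt[OF assms(1)] by metis
  have "st (q * x) * (q * x) = st x * a * x"
    using saD[OF pos_sa[OF q(1)]] assms(2) by (simp add: mult.assoc flip: q(2))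
  then show ?thesis using pos_st_mult[of "q * x"] saD(1)[OF pos_sa[OF q(1)]] assms(2) by simp
qed

text \<open>
  The constructed root \<open>r\<close> of \<open>s\<^sup>2\<close> commutes with every positive root \<open>u\<close>. For \<open>d = u - r\<close> the positive elements \<open>ud\<^sup>2\<close>
  and \<open>rd\<^sup>2\<close> add up to \<open>(u\<^sup>2 - r\<^sup>2)d = 0\<close>, hence both vanish, and \<open>d\<^sup>3\<close> is their difference.
\<close>

lemma pos_sqrt_unique:
  assumes "pos s" "pos s'" "s * s = s' * s'"
  shows "s = s'"
proof -
  obtain r where r: "pos r" "r * r = s * s"
      and comm: "\<And>w. w * (s * s) = s * s * w \<Longrightarrow> w * r = r * w"
    using pos_sqrt[OF pos_square[OF pos_sa[OF assms(1)]]] by metis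
  have "u = r" if u: "pos u" "u * u = s * s" for u
  proof -
    have ur: "u * r = r * u" by (rule comm) (simp add: mult.assoc flip: u(2))
    define d where "d = u - r"
    have d: "sa d" unfolding d_def by (intro sa_intros pos_sa u(1) r(1))
    have du: "d * u = u * d" and dr: "d * r = r * d"
      using ur by (simp_all add: d_def algebra_simps)
    have "(u + r) * d = 0" using ur u r by (simp add: d_def algebra_simps)
    then have "u * (d * d) + r * (d * d) = 0" by (simp flip: mult.assoc distrib_right)
    then have neg: "u * (d * d) = - (r * (d * d))" by (simp add: eq_neg_iff_add_eq_0)
    have "pos (u * (d * d))" "pos (r * (d * d))"
      using pos_mult_square u r d du dr by blast+
    then have "r * (d * d) = 0" using neg pos_antisym by simp
    then have "d * d * d = 0" using neg by (simp add: d_def left_diff_distrib mult.assoc)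
    then have "d = 0" using sa_cube_eq_0 d by blast
    then show ?thesis by (simp add: d_def)
  qed
  then show ?thesis using assms by metis
qed

end

section \<open>Bounded endomorphisms as a Banach algebra\<close>

text \<open>
  A type of its own, because bounded linear maps between two possibly different spaces carry no ring
  structure, while on endomorphisms composition is a ring multiplication.
\<close>

typedef (overloaded) ('a::real_normed_vector) endo = "UNIV :: ('a \<Rightarrow>\<^sub>L 'a) set"
  morphisms blinfun_of_endo endo_of_blinfun by simp

setup_lifting type_definition_endo

instantiation endo :: (real_normed_vector) real_normed_vector
begin

lift_definition zero_endo :: "'a endo" is 0 .
lift_definition plus_endo :: "'a endo \<Rightarrow> 'a endo \<Rightarrow> 'a endo" is "(+)" .
lift_definition minus_endo :: "'a endo \<Rightarrow> 'a endo \<Rightarrow> 'a endo" is "(-)" .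
lift_definition uminus_endo :: "'a endo \<Rightarrow> 'a endo" is "uminus" .
lift_definition scaleR_endo :: "real \<Rightarrow> 'a endo \<Rightarrow> 'a endo" is "(*\<^sub>R)" .
lift_definition norm_endo :: "'a endo \<Rightarrow> real" is norm .
lift_definition sgn_endo :: "'a endo \<Rightarrow> 'a endo" is sgn .
lift_definition dist_endo :: "'a endo \<Rightarrow> 'a endo \<Rightarrow> real" is dist .

definition uniformity_endo :: "('a endo \<times> 'a endo) filter"
  where "uniformity_endo = (INF e\<in>{0<..}. principal {(x, y). dist x y < e})"

definition open_endo :: "'a endo set \<Rightarrow> bool"
  where "open_endo S = (\<forall>x\<in>S. \<forall>\<^sub>F (x', y) in uniformity. x' = x \<longrightarrow> y \<in> S)"

instance
  by (standard; (unfold uniformity_endo_def open_endo_def)?; (transfer)?;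
      (auto simp: algebra_simps dist_norm sgn_div_norm norm_triangle_ineq)?)

end

instantiation endo :: (real_normed_vector) real_normed_algebra
begin

lift_definition times_endo :: "'a endo \<Rightarrow> 'a endo \<Rightarrow> 'a endo" is "(o\<^sub>L)" .

instance
  by (standard; transfer;
      (intro blinfun_eqI)?; simp add: norm_blinfun_compose blinfun.bilinear_simps)

end

instantiation endo :: (real_normed_vector) monoid_mult
begin

lift_definition one_endo :: "'a endo" is id_blinfun .

instance by (standard; transfer; (intro blinfun_eqI)?; simp)

end

instance endo :: (banach) banach
proof
  fix X :: "nat \<Rightarrow> 'a endo" assume "Cauchy X"
  then have "Cauchy (\<lambda>n. blinfun_of_endo (X n))"
    by (simp add: Cauchy_def dist_endo.rep_eq)
  then obtain l where "(\<lambda>n. blinfun_of_endo (X n)) \<longlonglongrightarrow> l"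
    by (auto simp: Cauchy_convergent_iff convergent_def)
  then have "X \<longlonglongrightarrow> endo_of_blinfun l"
    by (simp add: lim_sequentially dist_endo.rep_eq endo_of_blinfun_inverse)
  then show "convergent X" by (auto simp: convergent_def)
qed

definition app :: "'a::real_normed_vector endo \<Rightarrow> 'a \<Rightarrow> 'a"
  where "app e = blinfun_apply (blinfun_of_endo e)"

definition Endo :: "('a::real_normed_vector \<Rightarrow> 'a) \<Rightarrow> 'a endo"
  where "Endo T = endo_of_blinfun (Blinfun T)"

lemma app_Endo [simp]: "bounded_linear T \<Longrightarrow> app (Endo T) = T"
  by (simp add: app_def Endo_def endo_of_blinfun_inverse bounded_linear_Blinfun_apply)

lemma bounded_linear_app: "bounded_linear (app e)"
  by (simp add: app_def blinfun.bounded_linear_right)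

lemma app_inject: "app e = app f \<longleftrightarrow> e = f"
  by (simp add: app_def blinfun_apply_inject blinfun_of_endo_inject)

lemma Endo_app [simp]: "Endo (app e) = e"
  using app_inject app_Endo bounded_linear_app by blast

lemma app_simps [simp]:
  "app (e + f) x = app e x + app f x" "app (e - f) x = app e x - app f x"
  "app (- e) x = - app e x" "app (r *\<^sub>R e) x = r *\<^sub>R app e x"
  "app (e * f) x = app e (app f x)" "app 0 x = 0" "app 1 x = x"
  by (simp_all add: app_def plus_endo.rep_eq minus_endo.rep_eq uminus_endo.rep_eq
      scaleR_endo.rep_eq times_endo.rep_eq zero_endo.rep_eq one_endo.rep_eq blinfun.bilinear_simps)

lemma app_times: "app (e * f) = app e \<circ> app f"
  by auto

lemma norm_app_le: "norm (app e x) \<le> norm e * norm x"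
  by (simp add: app_def norm_endo.rep_eq norm_blinfun)

lemma norm_endo_le: "b \<ge> 0 \<Longrightarrow> (\<And>x. norm (app e x) \<le> b * norm x) \<Longrightarrow> norm e \<le> b"
  by (simp add: app_def norm_endo.rep_eq norm_blinfun_bound)

lemma tendsto_app: "X \<longlonglongrightarrow> e \<Longrightarrow> (\<lambda>n. app (X n) x) \<longlonglongrightarrow> app e x"
proof -
  assume X: "X \<longlonglongrightarrow> e"
  have "(\<lambda>n. norm (X n - e) * norm x) \<longlonglongrightarrow> 0"
    by (intro tendsto_mult_left_zero tendsto_norm_zero LIM_zero X)
  then have "(\<lambda>n. app (X n) x - app e x) \<longlonglongrightarrow> 0"
    by (rule Lim_null_comparison[rotated]) (auto simp: norm_app_le simp flip: app_simps)
  then show ?thesis by (rule LIM_zero_cancel)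
qed

section \<open>Adjointable operators form a C*-algebra\<close>

context hilbert_module
begin

lemma ip_add_left: "ip (x + y) z = ip x z + ip y z"
  by (metis ip_add_right star_add star_ip)

lemma ip_scaleC_left: "ip (c *\<^sub>C x) y = cnj c *\<^sub>C ip x y"
  by (metis ip_scaleC_right star_scaleC star_ip)

lemma ip_act_left: "ip (x \<odot> a) y = star a * ip x y"
  by (metis ip_act_right star_mult star_ip)

lemma ip_scaleR_right: "ip x (r *\<^sub>R y) = r *\<^sub>R ip x y"
  by (metis ip_scaleC_right scaleC_of_real)

lemma ip_scaleR_left: "ip (r *\<^sub>R x) y = r *\<^sub>R ip x y"
  by (metis ip_scaleC_left scaleC_of_real complex_cnj_complex_of_real)

lemma ip_zero [simp]: "ip x 0 = 0" "ip 0 x = 0"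
  using ip_scaleR_right[of x 0] ip_scaleR_left[of 0] by auto

lemma ip_diff_right: "ip x (y - z) = ip x y - ip x z"
  using ip_add_right[of x "y - z" z] by simp

lemma ip_diff_left: "ip (y - z) x = ip y x - ip z x"
  using ip_add_left[of "y - z" z x] by simp

lemmas ip_simps = ip_add_left ip_add_right ip_diff_left ip_diff_right ip_scaleR_left
  ip_scaleR_right ip_scaleC_left ip_scaleC_right ip_act_left ip_act_right

lemma ip_eqI: "(\<And>z. ip z x = ip z y) \<Longrightarrow> x = y"
  using ip_definite[of "x - y"] by (simp add: ip_diff_right)

lemma norm_ip_self: "norm (ip x x) = norm x * norm x"
  by (simp add: norm_eq_ip)

lemma adj_unique:
  assumes "\<And>x y. ip (T x) y = ip x (S y)"
  shows "adj T = S"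
  unfolding adj_def using assms by (intro the_equality) (auto intro!: ext ip_eqI)

lemma adjointableI: "(\<And>x y. ip (T x) y = ip x (S y)) \<Longrightarrow> adjointable T"
  by (auto simp: adjointable_def)

lemma ip_adj: assumes "adjointable T" shows "ip (T x) y = ip x (adj T y)"
  using assms adj_unique by (metis adjointable_def)

lemma ip_adj': assumes "adjointable T" shows "ip x (T y) = ip (adj T x) y"
  by (metis assms ip_adj star_ip)

lemma adjointable_adj: "adjointable T \<Longrightarrow> adjointable (adj T)"
  by (rule adjointableI[where S = T]) (simp add: ip_adj')

lemma adjointable_linear:
  assumes "adjointable T"
  shows "T (x + y) = T x + T y" "T (r *\<^sub>R x) = r *\<^sub>R T x" "T (c *\<^sub>C x) = c *\<^sub>C T x"
    "T (x \<odot> a) = T x \<odot> a"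
  by (rule ip_eqI, simp add: ip_adj'[OF assms] ip_simps)+

end

text \<open>
  Every Hilbert module belongs to this locale. It is separated because the proof of the
  inequality applies the results of the locale to the coefficient algebra.
\<close>

locale cauchy_schwarz_module = hilbert_module act ip
  for act :: "'h::complex_banach \<Rightarrow> 'a::cstar_algebra \<Rightarrow> 'h"  (infixl \<open>\<odot>\<close> 75)
    and ip :: "'h \<Rightarrow> 'h \<Rightarrow> 'a" +
  assumes norm_ip_le: "norm (ip x y) \<le> norm x * norm y"
begin

lemma bounded_bilinear_ip: "bounded_bilinear ip"
  by standard (auto simp: ip_simps intro!: exI[of _ 1] norm_ip_le)

text \<open>
  Uniform boundedness for the functionals \<open>\<lambda>y. ip (T x) y\<close> with \<open>x\<close> in the unit ball: they are pointwise bounded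
  because \<open>ip (T x) y = ip x (adj T y)\<close>. By Baire's theorem they are bounded by \<open>k\<close> on a common ball.
\<close>

lemma adjointable_bounded_linear:
  assumes "adjointable T"
  shows "bounded_linear T"
proof -
  define E where "E k = (\<Inter>x\<in>cball 0 1. {y. norm (ip (T x) y) \<le> real k})" for k :: nat
  have closed: "closed (E k)" for k
    unfolding E_def
    by (intro closed_INT ballI closed_Collect_le continuous_intros
        bounded_linear.continuous_on[OF bounded_bilinear.bounded_linear_right[OF bounded_bilinear_ip]])
  have "y \<in> (\<Union>k. E k)" for y
  proof -
    obtain k :: nat where k: "norm (adj T y) \<le> real k" using real_arch_simple by blast
    have "norm (ip (T x) y) \<le> real k" if "norm x \<le> 1" for x
    proof -
      have "norm (ip (T x) y) \<le> norm x * norm (adj T y)" using norm_ip_le ip_adj[OF assms] by metis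
      also have "\<dots> \<le> 1 * real k" using that k by (intro mult_mono) auto
      finally show ?thesis by simp
    qed
    then have "y \<in> E k" by (simp add: E_def)
    then show ?thesis by blast
  qed
  then have "\<Union>(range E) = UNIV" by auto
  have "\<exists>k. interior (E k) \<noteq> {}"
  proof (rule ccontr)
    assume "\<nexists>k. interior (E k) \<noteq> {}"
    then have "interior (\<Union>(range E)) = {}"
      using Met_TC.metric_Baire_category_alt[of "range E"] closed
      by (auto simp: mcomplete_iff_complete complete_UNIV)
    with \<open>\<Union>(range E) = UNIV\<close> show False by simp
  qed
  then obtain k y0 e where e: "e > 0" "cball y0 e \<subseteq> E k"
    by (metis ex_in_conv mem_interior_cball)
  have small: "norm (ip (T x) y) \<le> 2 * real k" if "norm x \<le> 1" "norm y \<le> e" for x y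
  proof -
    have "y0 \<in> E k" "y0 + y \<in> E k" using e that by (auto intro!: subsetD[OF e(2)] simp: dist_norm)
    then have "norm (ip (T x) y0) \<le> real k" "norm (ip (T x) (y0 + y)) \<le> real k"
      using that by (auto simp: E_def)
    moreover have "ip (T x) y = ip (T x) (y0 + y) - ip (T x) y0" by (simp add: ip_simps)
    ultimately show ?thesis by (smt (verit) norm_triangle_ineq4)
  qed
  have unit: "norm (T x) \<le> 2 * real k / e" if "norm x \<le> 1" for x
  proof (cases "T x = 0")
    case False
    \<comment> \<open>The test vector is the multiple of \<open>T x\<close> of norm \<open>e\<close>.\<close>
    then have "norm ((e / norm (T x)) *\<^sub>R T x) \<le> e" using e by simp
    from small[OF that this] have "norm (T x) * e \<le> 2 * real k"
      using False e by (simp add: ip_scaleR_right norm_ip_self mult.commute)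
    then show ?thesis using e by (simp add: field_simps)
  qed (use e in auto)
  have "norm (T x) \<le> norm x * (2 * real k / e)" for x
  proof (cases "x = 0")
    case True
    then show ?thesis using adjointable_linear(2)[OF assms, of 0 x] by simp
  next
    case False
    then show ?thesis
      using unit[of "(1 / norm x) *\<^sub>R x"] adjointable_linear(2)[OF assms, of "1 / norm x" x]
      by (simp add: field_simps)
  qed
  then show ?thesis
    by (intro bounded_linear_intro[where K = "2 * real k / e"] adjointable_linear[OF assms])
qed

definition ops :: "'h endo set"
  where "ops = {e. adjointable (app e)}"

definition opstar :: "'h endo \<Rightarrow> 'h endo"
  where "opstar e = Endo (adj (app e))"

definition imag_op :: "'h endo"
  where "imag_op = Endo (\<lambda>x. \<i> *\<^sub>C x)"

lemma opsD: "e \<in> ops \<Longrightarrow> adjointable (app e)"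
  by (simp add: ops_def)

lemma Endo_ops: "adjointable T \<Longrightarrow> Endo T \<in> ops \<and> app (Endo T) = T"
  by (simp add: ops_def adjointable_bounded_linear)

lemma app_opstar: "e \<in> ops \<Longrightarrow> app (opstar e) = adj (app e)"
  by (simp add: opstar_def ops_def adjointable_adj adjointable_bounded_linear)

lemma ip_opstar: "e \<in> ops \<Longrightarrow> ip (app e x) y = ip x (app (opstar e) y)"
  by (simp add: app_opstar ip_adj ops_def)

lemma opsI: "(\<And>x y. ip (app e x) y = ip x (app f y)) \<Longrightarrow> e \<in> ops \<and> opstar e = f"
  by (metis (no_types, lifting) Endo_app adj_unique adjointableI mem_Collect_eq ops_def opstar_def)

lemma norm_op_square_le:
  assumes "e \<in> ops"
  shows "(norm e)\<^sup>2 \<le> norm (opstar e * e)"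
proof -
  have "norm (app e x) \<le> sqrt (norm (opstar e * e)) * norm x" for x
  proof -
    have "norm (app e x) * norm (app e x) = norm (ip x (app (opstar e * e) x))"
      using ip_opstar[OF assms] by (simp flip: norm_ip_self)
    also have "\<dots> \<le> norm x * (norm (opstar e * e) * norm x)"
      by (rule order_trans[OF norm_ip_le]) (intro mult_left_mono norm_app_le norm_ge_zero)
    finally have "(norm (app e x))\<^sup>2 \<le> (sqrt (norm (opstar e * e)) * norm x)\<^sup>2"
      by (simp add: power_mult_distrib power2_eq_square mult_ac)
    then show ?thesis by (rule power2_le_imp_le) simp
  qed
  then have "norm e \<le> sqrt (norm (opstar e * e))" by (intro norm_endo_le) auto
  then have "(norm e)\<^sup>2 \<le> (sqrt (norm (opstar e * e)))\<^sup>2" by (intro power_mono) auto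
  then show ?thesis by simp
qed

lemma opstar_ops: "e \<in> ops \<Longrightarrow> opstar e \<in> ops \<and> opstar (opstar e) = e"
  by (rule opsI) (metis ip_opstar star_ip)

lemma norm_opstar:
  assumes "e \<in> ops"
  shows "norm (opstar e) = norm e"
proof -
  have "norm e \<le> norm (opstar e)" if "e \<in> ops" for e
  proof (cases "norm e = 0")
    case False
    have "norm e * norm e \<le> norm (opstar e) * norm e"
      using norm_op_square_le[OF that] norm_mult_ineq[of "opstar e" e]
      by (simp add: power2_eq_square)
    then show ?thesis using False by (simp add: mult_le_cancel_right)
  qed auto
  then show ?thesis using assms opstar_ops by (metis antisym)
qed

lemma ops_add: "e \<in> ops \<Longrightarrow> f \<in> ops \<Longrightarrow> e + f \<in> ops \<and> opstar (e + f) = opstar e + opstar f"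
  by (rule opsI) (simp add: ip_simps ip_opstar)

lemma ops_scaleR: "e \<in> ops \<Longrightarrow> r *\<^sub>R e \<in> ops \<and> opstar (r *\<^sub>R e) = r *\<^sub>R opstar e"
  by (rule opsI) (simp add: ip_simps ip_opstar)

lemma ops_mult: "e \<in> ops \<Longrightarrow> f \<in> ops \<Longrightarrow> e * f \<in> ops \<and> opstar (e * f) = opstar f * opstar e"
  by (rule opsI) (simp add: ip_opstar)

lemma app_imag_op: "app imag_op x = \<i> *\<^sub>C x"
proof -
  have "adjointable (\<lambda>x. \<i> *\<^sub>C x)"
    by (rule adjointableI[where S = "\<lambda>x. (- \<i>) *\<^sub>C x"]) (simp add: ip_simps)
  then show ?thesis by (simp add: imag_op_def Endo_ops)
qed

lemma scaleC_minus_left: "(- c) *\<^sub>C (x::'h) = - (c *\<^sub>C x)"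
  using scaleC_of_real[of "-1" "c *\<^sub>C x"] by (simp add: scaleC_scaleC)

text \<open>
  Taking adjoints is isometric, so the adjoints of a convergent sequence converge too, and their limit is an
  adjoint of the limit.
\<close>

lemma closed_ops: "closed ops"
  unfolding closed_sequential_limits
proof (intro allI impI, elim conjE)
  fix f e assume f: "\<forall>n::nat. f n \<in> ops" and lim: "f \<longlonglongrightarrow> e"
  have d: "opstar (f m) - opstar (f n) = opstar (f m - f n) \<and> f m - f n \<in> ops" for m n
    using ops_add[of "f m" "(-1) *\<^sub>R f n"] ops_scaleR[of "f n" "-1"] f by simp
  have "dist (opstar (f m)) (opstar (f n)) = dist (f m) (f n)" for m n
    using d[of m n] norm_opstar[of "f m - f n"] by (simp add: dist_norm)
  then have "Cauchy (\<lambda>n. opstar (f n))"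
    using LIMSEQ_imp_Cauchy[OF lim] by (simp add: Cauchy_def)
  then obtain s where s: "(\<lambda>n. opstar (f n)) \<longlonglongrightarrow> s"
    by (auto simp: Cauchy_convergent_iff convergent_def)
  have "ip (app e x) y = ip x (app s y)" for x y
  proof (rule LIMSEQ_unique)
    show "(\<lambda>n. ip (app (f n) x) y) \<longlonglongrightarrow> ip (app e x) y"
      by (intro bounded_bilinear.tendsto[OF bounded_bilinear_ip] tendsto_app lim tendsto_const)
    show "(\<lambda>n. ip (app (f n) x) y) \<longlonglongrightarrow> ip x (app s y)"
      using f by (simp add: ip_opstar)
        (intro bounded_bilinear.tendsto[OF bounded_bilinear_ip] tendsto_app s tendsto_const)
  qed
  then show "e \<in> ops" using opsI by blast
qed

sublocale unital_cstar ops opstar imag_op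
proof
  show "norm (opstar x * x) = (norm x)\<^sup>2" if "x \<in> ops" for x
    using norm_op_square_le[OF that] norm_mult_ineq[of "opstar x" x] norm_opstar[OF that]
    by (simp add: power2_eq_square)
  show "(1 :: 'h endo) \<in> ops" using opsI[of 1 1] by simp
  have "imag_op \<in> ops \<and> opstar imag_op = - imag_op"
    by (rule opsI) (simp add: app_imag_op ip_simps flip: scaleC_minus_left)
  then show "imag_op \<in> ops" "opstar imag_op = - imag_op" by auto
  show "imag_op * imag_op = - 1"
    using scaleC_of_real[of "-1"]
    by (auto simp: app_imag_op scaleC_scaleC fun_eq_iff simp flip: app_inject)
  show "imag_op * x = x * imag_op" if "x \<in> ops" for x
    by (auto simp: app_imag_op adjointable_linear[OF opsD[OF that]] simp flip: app_inject)
qed (auto simp: closed_ops ops_add ops_scaleR ops_mult opstar_ops)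

end

lemma norm_star [simp]: "norm (star a) = norm (a::'a::cstar_algebra)"
proof -
  have "norm a \<le> norm (star a)" for a :: 'a
  proof (cases "norm a = 0")
    case False
    have "norm a * norm a \<le> norm (star a) * norm a"
      using cstar_identity[of a] norm_mult_ineq[of "star a" a] by (simp add: power2_eq_square)
    then show ?thesis using False by (simp add: mult_le_cancel_right)
  qed auto
  then show ?thesis by (metis antisym star_star)
qed

section \<open>The Cauchy-Schwarz inequality\<close>

text \<open>
  The coefficient algebra as a Hilbert module over itself. Here the Cauchy-Schwarz inequality is immediate.
\<close>

interpretation self: cauchy_schwarz_module "(*) :: 'a::cstar_algebra \<Rightarrow> 'a \<Rightarrow> 'a" "\<lambda>a b. star a * b"
proof
  show "norm (star x * y) \<le> norm x * norm y" for x y :: 'a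
    using norm_mult_ineq[of "star x" y] by simp
  show "x = 0" if "star x * x = 0" for x :: 'a
    using cstar_identity[of x] that by simp
  show "cstar_positive (star x * x)" for x :: 'a
    by (auto simp: cstar_positive_def)
  show "norm x = sqrt (norm (star x * x))" for x :: 'a
    by (simp add: cstar_identity)
qed (auto simp: algebra_simps scaleC_mult_left scaleC_mult_right star_mult star_star)

text \<open>
  Left multiplication embeds the coefficient algebra, which may lack a unit, isometrically into a
  unital C*-algebra.
\<close>

definition left_mult :: "'a::cstar_algebra \<Rightarrow> 'a endo"
  where "left_mult a = Endo (\<lambda>b. a * b)"

lemma app_left_mult [simp]: "app (left_mult a) b = a * b"
  by (simp add: left_mult_def bounded_linear_mult_right)

lemma left_mult_ops: "left_mult a \<in> self.ops \<and> self.opstar (left_mult a) = left_mult (star a)"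
  by (rule self.opsI) (simp add: star_mult mult.assoc)

lemma left_mult_simps:
  "left_mult (a + b) = left_mult a + left_mult b" "left_mult (a - b) = left_mult a - left_mult b"
  "left_mult (a * b) = left_mult a * left_mult b"
  by (auto simp: algebra_simps simp flip: app_inject)

lemma norm_left_mult [simp]: "norm (left_mult a) = norm a"
proof (rule antisym)
  show "norm (left_mult a) \<le> norm a"
    by (rule norm_endo_le) (auto simp: norm_mult_ineq)
  have "norm a * norm a = norm (star (star a) * star a)"
    by (simp only: cstar_identity) (simp add: power2_eq_square)
  also have "\<dots> \<le> norm (left_mult a) * norm a"
    using norm_app_le[of "left_mult a" "star a"] by (simp add: star_star)
  finally show "norm a \<le> norm (left_mult a)"
    by (cases "norm a = 0") (auto simp: mult_le_cancel_right)
qed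

lemma pos_left_mult:
  assumes "cstar_positive a"
  shows "self.pos (left_mult a)"
proof -
  from assms obtain b where "a = star b * b" by (auto simp: cstar_positive_def)
  then have "left_mult a = self.opstar (left_mult b) * left_mult b"
    by (simp add: left_mult_ops left_mult_simps)
  moreover have "left_mult b \<in> self.ops" by (simp add: left_mult_ops)
  ultimately show ?thesis by (metis self.pos_st_mult)
qed

text \<open>
  Normalise \<open>x\<close> to \<open>x'\<close> and put \<open>a = ip x' y\<close>. Expanding the positive element \<open>ip (y - x'a) (y - x'a)\<close> and using
  \<open>ip x' x' \<le> 1\<close> gives \<open>a\<^sup>*a \<le> ip y y\<close>, where the order is that of the multiplication operators.
\<close>

lemma (in hilbert_module) cauchy_schwarz: "norm (ip x y) \<le> norm x * norm y"
proof (cases "x = 0")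
  case False
  define x' where "x' = (1 / norm x) *\<^sub>R x"
  define p where "p = left_mult (ip x' x')"
  define a where "a = ip x' y"
  define A where "A = left_mult a"
  define m where "m = left_mult (ip y y)"
  have A: "A \<in> self.ops" "self.opstar A = left_mult (star a)"
    using left_mult_ops by (auto simp: A_def)
  have "norm p \<le> 1" using False by (simp add: p_def norm_ip_self x'_def)
  moreover have "self.sa p"
    unfolding p_def by (rule self.pos_sa[OF pos_left_mult[OF ip_positive]])
  ultimately have "self.pos (1 - p)"
    unfolding self.pos_def by (auto intro!: self.sa_intros exI[of _ 1])
  then have 1: "self.pos (self.opstar A * (1 - p) * A)" using A self.pos_conj by blast
  have "ip (y - x' \<odot> a) (y - x' \<odot> a) = ip y y - star a * a - star a * a + star a * ip x' x' * a"
    by (simp add: ip_simps a_def star_ip algebra_simps)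
  then have "left_mult (ip (y - x' \<odot> a) (y - x' \<odot> a))
      = m - self.opstar A * A - self.opstar A * A + self.opstar A * p * A"
    by (simp only: A A_def[symmetric] m_def[symmetric] p_def[symmetric] left_mult_simps)
  also have "\<dots> = (m - self.opstar A * A) - self.opstar A * (1 - p) * A"
    by (simp add: algebra_simps)
  finally have "self.pos ((m - self.opstar A * A) - self.opstar A * (1 - p) * A)"
    using pos_left_mult[OF ip_positive] by metis
  from self.pos_add[OF this 1] have "self.pos (m - self.opstar A * A)" by simp
  then have "norm (self.opstar A * A) \<le> norm m"
    using self.norm_le_of_pos_diff self.pos_st_mult[OF A(1)] by blast
  then have "(norm a)\<^sup>2 \<le> (norm y)\<^sup>2"
    using self.norm_cstar[OF A(1)] by (simp add: A_def m_def norm_ip_self power2_eq_square)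
  then have "norm a \<le> norm y" by (rule power2_le_imp_le) simp
  then have "norm (ip x y) / norm x \<le> norm y" by (simp add: a_def x'_def ip_simps)
  then show ?thesis using False by (simp add: divide_le_eq mult.commute)
qed simp

lemma (in hilbert_module) cauchy_schwarz_module: "cauchy_schwarz_module (\<odot>) ip"
  by standard (rule cauchy_schwarz)

section \<open>Moore-Penrose inverses and polar decompositions in a C*-algebra\<close>

context unital_cstar
begin

definition absv :: "'e \<Rightarrow> 'e"
  where "absv t = (THE s. pos s \<and> s * s = st t * t)"

lemma absv_eqI:
  assumes "t \<in> B" "pos s" "s * s = st t * t"
  shows "absv t = s"
  unfolding absv_def using assms by (intro the_equality) (auto intro: pos_sqrt_unique)

lemma absv:
  assumes "t \<in> B"
  shows "pos (absv t)" "absv t * absv t = st t * t"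
  using pos_sqrt[OF pos_st_mult[OF assms]] absv_eqI[OF assms] by metis+

lemma absv_B [simp]: "t \<in> B \<Longrightarrow> absv t \<in> B"
  and st_absv [simp]: "t \<in> B \<Longrightarrow> st (absv t) = absv t"
  using saD[OF pos_sa[OF absv(1)]] by auto

definition moore_penrose :: "'e \<Rightarrow> 'e \<Rightarrow> bool"
  where "moore_penrose t x \<longleftrightarrow> x \<in> B \<and> t * x * t = t \<and> x * t * x = x \<and> st (t * x) = t * x \<and> st (x * t) = x * t"

lemma mp_sym: "t \<in> B \<Longrightarrow> moore_penrose t x \<Longrightarrow> moore_penrose x t"
  by (auto simp: moore_penrose_def)

lemma mp_st: "t \<in> B \<Longrightarrow> moore_penrose t x \<Longrightarrow> moore_penrose (st t) (st x)"
  unfolding moore_penrose_def by (metis mult.assoc mult_B st_B st_mult)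

lemma mp_unique:
  assumes t: "t \<in> B" and x: "moore_penrose t x" and y: "moore_penrose t y"
  shows "x = y"
proof -
  have B: "x \<in> B" "y \<in> B" using x y by (auto simp: moore_penrose_def)
  have "t * x = t * y * (t * x)" using y by (simp add: moore_penrose_def flip: mult.assoc)
  then have "st (t * x) = st (t * x) * st (t * y)" using t B by (metis mult_B st_mult)
  then have 1: "t * x = t * y" using x y by (simp add: moore_penrose_def) (simp flip: mult.assoc)
  have "x * t = x * t * (y * t)" using y by (simp add: moore_penrose_def mult.assoc)
  then have "st (x * t) = st (y * t) * st (x * t)" using t B by (metis mult_B st_mult)
  then have 2: "x * t = y * t" using x y by (simp add: moore_penrose_def mult.assoc)
  show ?thesis using x y 1 2 by (metis moore_penrose_def mult.assoc)
qed

text \<open>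
  The element \<open>xx\<^sup>*\<close> is the Moore-Penrose inverse of \<open>a\<^sup>*a\<close>, and \<open>xa\<close> is the product of the two in either order.
  Hence both \<open>c(xa)\<close> and \<open>(xa)c\<close> equal \<open>(xa)c(xa)\<close>.
\<close>

lemma commute_support:
  assumes a: "a \<in> B" and x: "moore_penrose a x" and c: "c * (st a * a) = st a * a * c"
  shows "c * (x * a) = x * a * c"
proof -
  define P M G where "P = x * a" and "M = st a * a" and "G = x * st x"
  have xB: "x \<in> B" using x by (simp add: moore_penrose_def)
  have stax: "st x * st a = a * x" and stxa: "st a * st x = x * a"
    using x a xB by (auto simp: moore_penrose_def)
  have GM: "G * M = P"
  proof -
    have "G * M = x * (st x * st a) * a" by (simp add: G_def M_def mult.assoc)
    also have "\<dots> = x * a * x * a" by (simp add: stax mult.assoc)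
    finally show ?thesis using x by (simp add: P_def moore_penrose_def)
  qed
  have MG: "M * G = P"
  proof -
    have "M * G = st a * (st x * st a) * st x" unfolding stax by (simp add: G_def M_def mult.assoc)
    also have "\<dots> = (x * a) * (x * a)" by (simp add: mult.assoc flip: stxa)
    finally show ?thesis using x by (simp add: P_def moore_penrose_def flip: mult.assoc)
  qed
  have MP: "M * P = M" using x by (simp add: M_def P_def moore_penrose_def mult.assoc)
  have PM: "P * M = M"
  proof -
    have "P * M = st (M * P)" using x a xB by (simp add: M_def P_def moore_penrose_def)
    then show ?thesis using MP a by (simp add: M_def)
  qed
  have cM: "c * M = M * c" using c by (simp add: M_def)
  have "P * c * P = c * P"
    by (metis MG PM cM mult.assoc)
  moreover have "P * c * P = P * c"
    by (metis GM MP cM mult.assoc)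
  ultimately show ?thesis by (simp add: P_def)
qed

text \<open>
  Write \<open>P = xa\<close> and \<open>Q = by\<close> for the two projections. Since \<open>Q\<close> commutes with \<open>a\<^sup>*a\<close>, it commutes with the
  Moore-Penrose inverse \<open>xx\<^sup>*\<close>; as \<open>x = xx\<^sup>*a\<^sup>*\<close> and \<open>axx\<^sup>* = x\<^sup>*\<close>, this turns \<open>aQx\<close> into its adjoint \<open>x\<^sup>*Qa\<^sup>*\<close>.
\<close>

lemma mp_mult_range_sa:
  assumes a: "a \<in> B" and b: "b \<in> B" and x: "moore_penrose a x" and y: "moore_penrose b y"
    and comm: "st a * a * (b * st b) = b * st b * (st a * a)"
  shows "x * a * (b * y) = b * y * (x * a)" "st (a * b * (y * x)) = a * b * (y * x)"
proof -
  define P Q M where "P = x * a" and "Q = b * y" and "M = st a * a"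
  have B: "x \<in> B" "y \<in> B" using x y by (auto simp: moore_penrose_def)
  have Q': "st y * st b = Q" using y b B by (simp add: moore_penrose_def Q_def)
  have QM: "M * Q = Q * M"
    using commute_support[OF st_B[OF b] mp_st[OF b y], of M] comm b by (simp add: M_def Q')
  show PQ: "x * a * (b * y) = b * y * (x * a)"
    using commute_support[OF a x, of Q] QM by (simp add: P_def Q_def M_def)
  have stax: "st x * st a = a * x" and stxa: "st a * st x = x * a"
    using x a B by (auto simp: moore_penrose_def)
  have GM: "x * st x * M = P"
    by (metis M_def P_def moore_penrose_def mult.assoc stax x)
  have MG: "M * (x * st x) = P"
    by (metis M_def P_def moore_penrose_def mult.assoc stax stxa x)
  have Px: "P * x = x" using x by (simp add: moore_penrose_def P_def)
  have stP: "st x * P = st x" by (metis P_def moore_penrose_def mult.assoc stax stxa mp_st[OF a x])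
  have G: "Q * (x * st x) = x * st x * Q"
  proof -
    have "Q * (x * st x) = P * Q * (x * st x)"
      using PQ Px by (metis P_def Q_def mult.assoc)
    also have "\<dots> = x * st x * (M * Q) * (x * st x)" by (simp add: mult.assoc flip: GM)
    also have "\<dots> = x * st x * Q * P" unfolding QM by (simp add: mult.assoc flip: MG)
    also have "\<dots> = x * st x * Q" using PQ stP by (metis P_def Q_def mult.assoc)
    finally show ?thesis .
  qed
  have x': "x = x * st x * st a" using x by (simp add: moore_penrose_def stax mult.assoc)
  have ax: "a * x * st x = st x" by (metis moore_penrose_def mp_st[OF a x] stax mult.assoc)
  have "a * Q * x = a * (Q * (x * st x)) * st a"
    using x' by (metis mult.assoc)
  also have "\<dots> = a * x * st x * Q * st a" unfolding G by (simp add: mult.assoc)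
  also have "\<dots> = st x * Q * st a" unfolding ax ..
  also have "\<dots> = st (a * Q * x)"
    using a b B y by (simp add: Q_def moore_penrose_def mult.assoc)
  finally show "st (a * b * (y * x)) = a * b * (y * x)" by (simp add: Q_def mult.assoc)
qed

text \<open>
  The reverse order law. That \<open>yxab\<close> is self-adjoint is the previous lemma for the adjoint product
  \<open>b\<^sup>*a\<^sup>*\<close>.
\<close>

lemma mp_mult:
  assumes a: "a \<in> B" and b: "b \<in> B" and x: "moore_penrose a x" and y: "moore_penrose b y"
    and comm: "st a * a * (b * st b) = b * st b * (st a * a)"
  shows "moore_penrose (a * b) (y * x)"
proof -
  have B: "x \<in> B" "y \<in> B" using x y by (auto simp: moore_penrose_def)
  note PQ = mp_mult_range_sa(1)[OF assms]
  have "a * b * (y * x) * (a * b) = a * (b * y * (x * a)) * b" by (simp add: mult.assoc)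
  also have "\<dots> = (a * x * a) * (b * y * b)" unfolding PQ[symmetric] by (simp add: mult.assoc)
  finally have 1: "a * b * (y * x) * (a * b) = a * b" using x y by (simp add: moore_penrose_def)
  have "y * x * (a * b) * (y * x) = y * (x * a * (b * y)) * x" by (simp add: mult.assoc)
  also have "\<dots> = (y * b * y) * (x * a * x)" unfolding PQ by (simp add: mult.assoc)
  finally have 2: "y * x * (a * b) * (y * x) = y * x" using x y by (simp add: moore_penrose_def)
  have "st (st b * st a * (st x * st y)) = st b * st a * (st x * st y)"
    by (rule mp_mult_range_sa(2)[OF _ _ mp_st[OF b y] mp_st[OF a x]])
      (use a b comm in simp_all)
  then have "st (y * x * (a * b)) = y * x * (a * b)" using a b B by (simp add: mult.assoc)
  then show ?thesis using 1 2 mp_mult_range_sa(2)[OF assms] B by (simp add: moore_penrose_def)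
qed

text \<open>
  The purely algebraic content of a polar decomposition: the initial projection of \<open>u\<close> is only required to
  dominate the support of \<open>t\<close>. That it equals the support is stated separately where it matters.
\<close>

definition polar :: "'e \<Rightarrow> 'e \<Rightarrow> bool"
  where "polar t u \<longleftrightarrow> u \<in> B \<and> u * absv t = t \<and> u * (st u * u) = u \<and> t * (st u * u) = t"

lemma idem_imp_partial_isometry:
  assumes u: "u \<in> B" and idem: "st u * u * (st u * u) = st u * u"
  shows "u * (st u * u) = u"
proof -
  define e where "e = st u * u"
  have e: "e \<in> B" "st e = e" "e * e = e" using u idem by (auto simp: e_def)
  have "st (u * e - u) * (u * e - u) = e * e * e - e * e - e * e + e"
    using u e by (simp add: left_diff_distrib right_diff_distrib mult.assoc)
      (simp add: e_def mult.assoc)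
  also have "\<dots> = 0" by (simp add: e(3))
  finally have "u * e - u = 0" by (rule st_self_mult_eq_0[rotated]) (use u e in simp)
  then show ?thesis by (simp add: e_def)
qed

text \<open>
  For the projections \<open>P = u\<^sup>*u\<close> and \<open>Q = vv\<^sup>*\<close>, that \<open>uv\<close> is a partial isometry says \<open>PQPQ = PQ\<close>. Then \<open>D = QP - PQP\<close>
  satisfies \<open>D\<^sup>*D = 0\<close>, so \<open>QP = PQP\<close> is self-adjoint.
\<close>

lemma partial_isometry_mult_commute:
  assumes u: "u \<in> B" "u * (st u * u) = u" and v: "v \<in> B" "v * (st v * v) = v"
    and uv: "u * v * (st (u * v) * (u * v)) = u * v"
  shows "st u * u * (v * st v) = v * st v * (st u * u)"
proof -
  define P Q where "P = st u * u" and "Q = v * st v"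
  have PB: "P \<in> B" "st P = P" "P * P = P" and QB: "Q \<in> B" "st Q = Q" "Q * Q = Q"
    using u v by (simp_all add: P_def Q_def mult.assoc) (metis mult.assoc)+
  have "st u * (u * v * (st (u * v) * (u * v))) * st v = st u * (u * v) * st v"
    by (simp only: uv)
  then have PQPQ: "P * Q * P * Q = P * Q"
    using u(1) v(1) by (simp add: P_def Q_def mult.assoc)
  \<comment> \<open>This is the adjoint of \<open>PQ - PQP\<close>.\<close>
  define D where "D = Q * P - P * Q * P"
  have D: "D \<in> B" "st D = P * Q - P * Q * P" using PB QB by (simp_all add: D_def mult.assoc)
  have "st D * D = 0"
    unfolding D(2) unfolding D_def
    using PQPQ PB(3) QB(3)
    by (simp add: left_diff_distrib right_diff_distrib) (metis (no_types, lifting) mult.assoc diff_self)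
  then have "Q * P = P * Q * P" using st_self_mult_eq_0[OF D(1)] by (simp add: D_def)
  moreover have "P * Q = P * Q * P"
  proof -
    have "P * Q = st (Q * P)" using PB QB by simp
    also have "\<dots> = st (P * Q * P)" by (simp only: \<open>Q * P = P * Q * P\<close>)
    also have "\<dots> = P * Q * P" using PB QB by (simp add: mult.assoc)
    finally show ?thesis .
  qed
  ultimately show ?thesis by (metis P_def Q_def)
qed

lemma absv_mult_support:
  assumes t: "t \<in> B" and u: "polar t u"
  shows "absv t * (st u * u) = absv t"
proof -
  define e s where "e = st u * u" and "s = absv t"
  have uB: "u \<in> B" and te: "t * e = t" using u by (auto simp: polar_def e_def)
  have e: "e \<in> B" "st e = e" using uB by (auto simp: e_def)
  have et: "e * st t = st t" using te e t st_mult by metis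
  have s: "s \<in> B" "st s = s" "s * s = st t * t" using t absv by (auto simp: s_def)
  have "st (s * e - s) * (s * e - s) = e * (s * s) * e - e * (s * s) - s * s * e + s * s"
    using s(1,2) e by (simp add: left_diff_distrib right_diff_distrib mult.assoc)
  also have "\<dots> = 0"
    unfolding s(3) using te et by (simp add: mult.assoc)
  finally have "s * e - s = 0" by (rule st_self_mult_eq_0[rotated]) (use s e in simp)
  then show ?thesis by (simp add: e_def s_def)
qed

text \<open>
  The positive element \<open>h = v|b|v\<^sup>*\<close> is the absolute value of \<open>b\<^sup>*\<close>, and \<open>b = hv\<close>. Cancelling \<open>u\<close> and \<open>v\<close> in
  \<open>u|a|hv = ab = uv|ab|\<close> expresses \<open>|a|h\<close> as \<open>Pv|ab|v\<^sup>*\<close> with \<open>P = u\<^sup>*u\<close>. Because \<open>P\<close> commutes with \<open>vv\<^sup>*\<close> and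
  \<open>|ab|\<close> absorbs \<open>v\<^sup>*Pv\<close>, this equals \<open>Pv|ab|v\<^sup>*P\<close>, which is self-adjoint. So \<open>|a|\<close> and \<open>h\<close> commute, and their
  squares are \<open>a\<^sup>*a\<close> and \<open>bb\<^sup>*\<close>.
\<close>

lemma polar_mult_commute:
  assumes a: "a \<in> B" "polar a u" and b: "b \<in> B" "polar b v" and ab: "polar (a * b) (u * v)"
  shows "st a * a * (b * st b) = b * st b * (st a * a)"
proof -
  define P Q where "P = st u * u" and "Q = v * st v"
  define h where "h = v * absv b * st v"
  define r s where "r = absv a" and "s = absv (a * b)"
  have uv: "u \<in> B" "v \<in> B" using a(2) b(2) by (auto simp: polar_def)
  have rs: "r \<in> B" "st r = r" "s \<in> B" "st s = s" "r * r = st a * a"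
    using a b absv by (auto simp: r_def s_def)
  have sup: "r * P = r" "absv b * (st v * v) = absv b" "s * (st v * P * v) = s"
    using absv_mult_support[OF a] absv_mult_support[OF b] absv_mult_support[OF _ ab] a(1) b(1) uv
    by (simp_all add: r_def s_def P_def mult.assoc)
  have h: "h \<in> B" "st h = h" using uv b(1) by (simp_all add: h_def mult.assoc)
  have hv: "h * v = b" using sup(2) b(2) by (simp add: h_def polar_def mult.assoc)
  have hh: "h * h = b * st b"
  proof -
    have "h * h = h * v * (absv b * st v)" by (simp add: h_def mult.assoc)
    also have "absv b * st v = st (v * absv b)" using uv b(1) by simp
    finally show ?thesis using hv b(2) by (simp add: polar_def)
  qed
  have Pr: "P * r = r"
  proof -
    have "P * r = st (r * P)" using rs uv by (simp add: P_def)
    then show ?thesis using sup(1) rs by simp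
  qed
  have hQ: "h * Q = h"
  proof -
    have "h * Q = v * (absv b * (st v * v)) * st v" by (simp add: h_def Q_def mult.assoc)
    then show ?thesis unfolding sup(2) by (simp add: h_def)
  qed
  have PQ: "P * Q = Q * P" unfolding P_def Q_def
    by (rule partial_isometry_mult_commute) (use a(2) b(2) ab in \<open>auto simp: polar_def\<close>)
  have vQ: "Q * v = v" using b(2) by (simp add: polar_def Q_def mult.assoc)
  have "u * v * s = u * r * (h * v)"
    using ab a(2) hv by (simp add: polar_def s_def r_def)
  then have "st u * (u * v * s) * st v = st u * (u * r * (h * v)) * st v" by simp
  then have "P * v * s * st v = (P * r) * (h * Q)" by (simp add: P_def Q_def mult.assoc)
  then have "r * h = P * v * s * st v" by (simp add: Pr hQ)
  also have "\<dots> = P * v * s * st v * P * Q"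
  proof -
    have "P * v * s * st v = P * v * (s * (st v * P * v)) * st v" by (simp only: sup(3))
    also have "\<dots> = P * v * s * st v * P * Q" by (simp add: Q_def mult.assoc)
    finally show ?thesis .
  qed
  also have "\<dots> = P * v * s * st (Q * v) * P"
  proof -
    have "st (Q * v) = st v * Q" using uv by (simp add: Q_def mult.assoc)
    then show ?thesis using PQ by (simp add: mult.assoc)
  qed
  finally have rh: "r * h = P * v * s * st v * P" by (simp add: vQ)
  have "st (P * v * s * st v * P) = P * v * s * st v * P"
    using uv rs by (simp add: P_def mult.assoc)
  then have "r * h = st (r * h)" by (simp add: rh)
  then have "r * h = h * r" using rs h by simp
  then have "r * r * (h * h) = h * h * (r * r)" by (metis mult.assoc)
  then show ?thesis by (simp add: rs(5) hh)
qed

text \<open>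
  The element \<open>c = xv\<close> is the Moore-Penrose inverse of \<open>r = |a|\<close>; it is self-adjoint and \<open>c = crc\<close>. Therefore
  \<open>vx = vcv\<^sup>*\<close> is positive, and its square is \<open>x\<^sup>*v\<^sup>*vx = x\<^sup>*x\<close>.
\<close>

lemma polar_mp:
  assumes a: "a \<in> B" and x: "moore_penrose a x" and v: "polar a v" and sup: "st v * v = x * a"
  shows "absv x = v * x" "v * st v = a * x" "st v * (v * x) = x"
proof -
  define c r where "c = x * v" and "r = absv a"
  have B: "x \<in> B" "v \<in> B" "r \<in> B" "st r = r" "c \<in> B"
    using x v a by (auto simp: moore_penrose_def polar_def r_def c_def)
  have vr: "v * r = a" using v by (simp add: polar_def r_def)
  have vv: "v * (st v * v) = v" using v by (simp add: polar_def)
  have vv': "st v * v * st v = st v"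
    using arg_cong[OF vv, of st] B by (simp add: mult.assoc)
  have va: "st v * a = r"
  proof -
    have "st (r * (st v * v)) = st r" using absv_mult_support[OF a v] by (simp add: r_def)
    then have "st v * v * r = r" using B by simp
    then show ?thesis using vr by (simp add: mult.assoc)
  qed
  have av: "st a * v = r"
    using arg_cong[OF va, of st] B a by simp
  have stax: "st x * st a = a * x" and stxa: "st a * st x = x * a"
    using x a B by (auto simp: moore_penrose_def)
  have rc: "r * c = st v * (a * x) * v" by (simp add: c_def mult.assoc flip: va)
  have cr: "c * r = x * a" by (simp add: c_def vr mult.assoc)
  have pc: "x * a * c = c" using x by (simp add: c_def moore_penrose_def flip: mult.assoc)
  have cp: "c * (x * a) = c" by (simp add: c_def vv mult.assoc flip: sup)
  have "r * st c = st (c * r)" using B by simp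
  also have "\<dots> = x * a" unfolding cr using x by (simp add: moore_penrose_def)
  finally have rstc: "r * st c = x * a" .
  have "c = c * r * st c" using cp rstc by (simp add: mult.assoc)
  also have "\<dots> = st (c * (x * a))" using x B a by (simp add: cr moore_penrose_def)
  finally have stc: "st c = c" using cp by simp
  have xvv: "x * (v * st v) = x"
  proof -
    have "x * (v * st v) = x * (st x * st a) * (v * st v)" using x by (simp add: stax moore_penrose_def flip: mult.assoc)
    also have "\<dots> = x * (st x * (r * st v))" by (simp add: mult.assoc flip: av)
    also have "r * st v = st a" using arg_cong[OF vr, of st] B by simp
    also have "x * (st x * st a) = x" using x by (simp add: stax moore_penrose_def flip: mult.assoc)
    finally show ?thesis .
  qed
  have vx: "v * x = v * c * st v" using xvv by (simp add: c_def mult.assoc)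
  have crc: "c * r * c = c" using pc cr by simp
  have "pos r" using absv(1)[OF a] by (simp add: r_def)
  moreover have "c * st v \<in> B" using B by simp
  ultimately have "pos (st (c * st v) * r * (c * st v))" by (rule pos_conj)
  also have "st (c * st v) * r * (c * st v) = v * (c * r * c) * st v"
    using B stc by (simp add: mult.assoc)
  finally have pos: "pos (v * x)" by (simp add: crc vx)
  have xx: "st v * (v * x) = x" using x by (simp add: sup moore_penrose_def flip: mult.assoc)
  then show "st v * (v * x) = x" .
  have "v * x * (v * x) = st (v * x) * (v * x)" using pos pos_sa by (metis saD(2))
  also have "\<dots> = st x * (st v * (v * x))" using B by (simp add: mult.assoc)
  finally have "v * x * (v * x) = st x * x" by (simp add: xx)
  then show "absv x = v * x" using absv_eqI[OF B(1) pos] by simp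
  show "v * st v = a * x"
  proof -
    have "v * st v = v * (st v * v) * st v" by (simp add: vv)
    also have "\<dots> = v * (st a * st x) * st v" by (simp add: sup stxa)
    also have "\<dots> = v * (r * st v) * st x * st v"
      by (metis B(3,4) B(2) mult.assoc st_mult vr)
    finally have e: "v * st v = a * (st v * st x * st v)" by (simp add: vr flip: mult.assoc)
    have "a * x * (v * st v) = a * x" using xvv by (simp add: mult.assoc)
    moreover have "a * x * (v * st v) = v * st v"
      unfolding e using x by (simp add: moore_penrose_def flip: mult.assoc)
    ultimately show ?thesis by simp
  qed
qed

end

section \<open>Polar decompositions and n-centered operators on Hilbert modules\<close>

context cauchy_schwarz_module
begin

lemma op_positive_iff: "op_positive S \<longleftrightarrow> (\<exists>s. S = app s \<and> pos s)"
proof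
  assume "op_positive S"
  then obtain R where R: "adjointable R" "S = adj R \<circ> R" by (auto simp: op_positive_def)
  define e where "e = Endo R"
  have e: "e \<in> ops" "app e = R" using Endo_ops[OF R(1)] by (auto simp: e_def)
  then have "S = app (opstar e * e)" by (simp add: app_times app_opstar R(2))
  then show "\<exists>s. S = app s \<and> pos s" using pos_st_mult[OF e(1)] by blast
next
  assume "\<exists>s. S = app s \<and> pos s"
  then obtain s where s: "S = app s" "pos s" by blast
  obtain r where r: "pos r" "r * r = s" using pos_sqrt[OF s(2)] by metis
  have "r \<in> ops" "opstar r = r" using pos_sa[OF r(1)] by auto
  then have "adjointable (app r)" "S = adj (app r) \<circ> app r"
    using app_opstar[of r] by (simp_all add: opsD s(1) app_times flip: r(2))
  then show "op_positive S" by (auto simp: op_positive_def)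
qed

lemma op_abs_app:
  assumes "t \<in> ops"
  shows "op_abs (app t) = app (absv t)"
  unfolding op_abs_def
proof (rule the_equality)
  have *: "adj (app t) \<circ> app t = app (opstar t * t)"
    using assms by (simp add: app_times app_opstar)
  show "op_positive (app (absv t)) \<and> app (absv t) \<circ> app (absv t) = adj (app t) \<circ> app t"
    unfolding * op_positive_iff using absv[OF assms] by (auto simp flip: app_times)
  fix S assume S: "op_positive S \<and> S \<circ> S = adj (app t) \<circ> app t"
  then obtain s where "S = app s" "pos s" by (auto simp: op_positive_iff)
  with S show "S = app (absv t)"
    unfolding * using absv_eqI[OF assms] by (simp add: app_inject flip: app_times)
qed

lemma proj_onto_eqI:
  assumes M: "submodule M" and y: "y \<in> M" "x - y \<in> ortho_complement M"
  shows "proj_onto M x = y"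
  unfolding proj_onto_def
proof (rule the_equality)
  fix z assume z: "z \<in> M \<and> x - z \<in> ortho_complement M"
  have "z + (-1) *\<^sub>C y \<in> M" using M z y by (auto simp: submodule_def)
  then have "z - y \<in> M" using scaleC_of_real[of "-1" y] by simp
  then have "ip (z - y) (x - y) = 0" "ip (z - y) (x - z) = 0"
    using y z by (auto simp: ortho_complement_def)
  then have "ip (z - y) (z - y) = 0" by (simp add: ip_simps)
  then show "z = y" using ip_definite by fastforce
qed (use y in auto)

lemma proj_onto_complemented:
  assumes "ortho_complemented M"
  shows "proj_onto M x \<in> M" "x - proj_onto M x \<in> ortho_complement M"
proof -
  obtain y z where "y \<in> M" "z \<in> ortho_complement M" "x = y + z"
    using assms unfolding ortho_complemented_def by blast
  moreover from this have "proj_onto M x = y"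
    using assms by (intro proj_onto_eqI) (auto simp: ortho_complemented_def)
  ultimately show "proj_onto M x \<in> M" "x - proj_onto M x \<in> ortho_complement M" by auto
qed

lemma fixed_points_complemented:
  assumes p: "p \<in> ops" "opstar p = p" "p * p = p"
  shows "ortho_complemented {y. app p y = y}" "proj_onto {y. app p y = y} = app p"
proof -
  let ?M = "{y. app p y = y}"
  have M: "submodule ?M"
    using linear_0[OF bounded_linear.linear[OF bounded_linear_app[of p]]]
    by (simp add: submodule_def adjointable_linear[OF opsD[OF p(1)]])
  have pp: "app p (app p x) = app p x" for x by (metis app_simps(5) p(3))
  have perp: "x - app p x \<in> ortho_complement ?M" for x
    unfolding ortho_complement_def
  proof (intro CollectI ballI)
    fix y assume "y \<in> ?M"
    then have "ip y (x - app p x) = ip (app p y) (x - app p x)" by simp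
    also have "\<dots> = ip y (app p (x - app p x))" using ip_opstar[OF p(1)] p(2) by simp
    also have "app p (x - app p x) = 0"
      using pp bounded_linear.linear[OF bounded_linear_app[of p]] by (simp add: linear_diff)
    finally show "ip y (x - app p x) = 0" by simp
  qed
  have "closed ?M"
    by (intro closed_Collect_eq continuous_intros linear_continuous_on bounded_linear_app)
  then show "ortho_complemented ?M"
    unfolding ortho_complemented_def
  proof (intro conjI allI M)
    fix x
    show "\<exists>y\<in>?M. \<exists>z\<in>ortho_complement ?M. x = y + z"
      by (rule bexI[of _ "app p x"], rule bexI[of _ "x - app p x"]) (simp_all add: pp perp)
  qed
  show "proj_onto ?M = app p"
    by (rule ext, rule proj_onto_eqI[OF M]) (use pp perp in auto)
qed

text \<open>
  The last property says, without mentioning ranges, that the initial projection of \<open>u\<close> is no larger than the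
  closure of the range of the adjoint: every operator that fixes the range of \<open>t\<^sup>*\<close> fixes the range of \<open>u\<^sup>*u\<close>.
\<close>

lemma polar_decompD:
  assumes t: "t \<in> ops" and U: "polar_decomp (app t) U"
  obtains u where "U = app u" "polar t u" "\<And>q. q * opstar t = opstar t \<Longrightarrow> q * (opstar u * u) = opstar u * u"
proof -
  define M where "M = closure (range (adj (app t)))"
  have U': "adjointable U" "is_projection (adj U \<circ> U)" "app t = U \<circ> op_abs (app t)"
      "ortho_complemented M" "adj U \<circ> U = proj_onto M"
    using U by (auto simp: polar_decomp_def partial_isometry_def M_def)
  define u where "u = Endo U"
  have u: "u \<in> ops" "app u = U" using Endo_ops[OF U'(1)] by (auto simp: u_def)
  define e where "e = opstar u * u"
  have e: "app e = proj_onto M" using u U'(5) by (simp add: e_def app_times app_opstar)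
  have "app (u * absv t) = app t"
    using U'(3) u(2) by (simp add: op_abs_app[OF t] app_times)
  then have "u * absv t = t" by (simp only: app_inject)
  moreover have "app (e * e) = app e"
    using U'(2) unfolding is_projection_def app_times e U'(5) by simp
  then have "u * e = u" using idem_imp_partial_isometry[OF u(1)] by (simp add: e_def app_inject)
  moreover have "t * e = t"
  proof -
    have "app t (x - app e x) = 0" for x
    proof (rule ip_eqI)
      fix z
      have "adj (app t) z \<in> M" unfolding M_def by (rule subsetD[OF closure_subset]) simp
      then have "ip (adj (app t) z) (x - app e x) = 0"
        using proj_onto_complemented(2)[OF U'(4)] by (simp add: ortho_complement_def e)
      then show "ip z (app t (x - app e x)) = ip z 0" by (simp add: ip_adj' opsD t)
    qed
    then have "app (t * e) = app t"
      using bounded_linear.linear[OF bounded_linear_app[of t]] by (auto simp: linear_diff fun_eq_iff)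
    then show ?thesis by (simp add: app_inject)
  qed
  moreover have "q * e = e" if q: "q * opstar t = opstar t" for q
  proof -
    have "app q (adj (app t) x) = adj (app t) x" for x
      using q t by (metis app_opstar app_simps(5))
    then have "range (adj (app t)) \<subseteq> {y. app q y = y}" by auto
    moreover have "closed {y. app q y = y}"
      by (intro closed_Collect_eq continuous_intros linear_continuous_on bounded_linear_app)
    ultimately have "M \<subseteq> {y. app q y = y}" unfolding M_def by (rule closure_minimal)
    then have "app q (app e x) = app e x" for x
      using proj_onto_complemented(1)[OF U'(4), of x] by (auto simp: e)
    then have "app (q * e) = app e" by auto
    then show ?thesis by (simp add: app_inject)
  qed
  ultimately show ?thesis using that u by (auto simp: polar_def e_def)
qed

text \<open>
  When \<open>t\<close> has a Moore-Penrose inverse \<open>x\<close>, the range of its adjoint is the set of fixed points of the projection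
  \<open>xt\<close>. So this range is closed and complemented.
\<close>

lemma polar_decompI:
  assumes t: "t \<in> ops" "moore_penrose t x" and u: "u \<in> ops" "u * absv t = t" "opstar u * u = x * t"
  shows "polar_decomp (app t) (app u)"
proof -
  define p where "p = x * t"
  have p: "p \<in> ops" "opstar p = p" "p * p = p"
    using t by (simp_all add: p_def moore_penrose_def flip: mult.assoc)
  have "opstar t = opstar (t * p)" using t by (simp add: moore_penrose_def p_def flip: mult.assoc)
  also have "\<dots> = p * opstar t" using p t(1) by simp
  finally have "opstar t = p * opstar t" .
  moreover have "p = opstar t * opstar x"
    using p(2) t st_mult[of x t] by (simp add: p_def moore_penrose_def)
  ultimately have "range (app (opstar t)) = {y. app p y = y}"
    by (auto simp: image_iff) (metis app_simps(5))+
  then have r: "range (adj (app t)) = {y. app p y = y}" using t by (simp add: app_opstar)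
  have cl: "closure {y. app p y = y} = {y. app p y = y}"
    by (intro closure_closed closed_Collect_eq continuous_intros linear_continuous_on bounded_linear_app)
  have e: "adj (app u) \<circ> app u = app p" 
    unfolding p_def u(3)[symmetric] app_times app_opstar[OF u(1)] ..
  show ?thesis
    unfolding polar_decomp_def partial_isometry_def is_projection_def r cl e
    using fixed_points_complemented[OF p] u(1,2) t(1) p
    by (simp add: opsD op_abs_app app_opstar[symmetric] flip: app_times)
qed

text \<open>
  If \<open>t\<close> has a Moore-Penrose inverse \<open>x\<close>, the initial projection \<open>e\<close> of \<open>u\<close> is \<open>xt\<close>: it is no larger because \<open>xt\<close> fixes
  the range of \<open>t\<^sup>*\<close>, and no smaller because \<open>te = t\<close>.
\<close>

lemma polar_decomp_support:
  assumes t: "t \<in> ops" "moore_penrose t x" and U: "polar_decomp (app t) (app u)"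
  shows "polar t u" "opstar u * u = x * t"
proof -
  obtain u' where u': "app u = app u'" "polar t u'"
    "\<And>q. q * opstar t = opstar t \<Longrightarrow> q * (opstar u' * u') = opstar u' * u'"
    using polar_decompD[OF t(1) U] by metis
  then show u: "polar t u" by (simp add: app_inject)
  define e where "e = opstar u * u"
  have e: "e \<in> ops" "opstar e = e" "t * e = t" using u by (auto simp: e_def polar_def)
  have p: "x * t \<in> ops" "opstar (x * t) = x * t" using t by (auto simp: moore_penrose_def)
  have "opstar (x * t) * opstar t = opstar t"
    using t(1) p(1) t(2) by (metis moore_penrose_def mult.assoc mult_B st_mult)
  then have "x * t * e = e" using u'(1,3) p(2) by (simp add: e_def app_inject)
  moreover have "x * t * e = x * t" using e(3) by (simp add: mult.assoc)
  ultimately show "opstar u * u = x * t" by (simp add: e_def)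
qed

lemma polar_decomp_mp:
  assumes t: "t \<in> ops" "moore_penrose t x" and U: "polar_decomp (app t) (app u)"
  shows "polar_decomp (app x) (app (opstar u))"
proof -
  note u = polar_decomp_support[OF assms]
  note x = polar_mp[OF t u]
  have B: "x \<in> ops" "u \<in> ops" using t u by (auto simp: moore_penrose_def polar_def)
  show ?thesis
    by (rule polar_decompI[OF B(1) mp_sym[OF t]]) (use B x in simp_all)
qed

lemma is_MP_inverse_iff:
  assumes "t \<in> ops"
  shows "is_MP_inverse (app t) X \<longleftrightarrow> (\<exists>x. X = app x \<and> moore_penrose t x)"
proof -
  have *: "is_MP_inverse (app t) (app x) \<longleftrightarrow> moore_penrose t x" if "x \<in> ops" for x
    using that assms unfolding is_MP_inverse_def moore_penrose_def
    by (simp add: opsD app_inject flip: app_times app_opstar)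
  show ?thesis
  proof
    assume "is_MP_inverse (app t) X"
    then have "adjointable X" by (simp add: is_MP_inverse_def)
    then show "\<exists>x. X = app x \<and> moore_penrose t x"
      using Endo_ops *[of "Endo X"] \<open>is_MP_inverse (app t) X\<close> by metis
  next
    assume "\<exists>x. X = app x \<and> moore_penrose t x"
    then show "is_MP_inverse (app t) X" using * by (auto simp: moore_penrose_def)
  qed
qed

lemma app_power: "app (t ^ k) = app t ^^ k"
  by (induction k) (auto simp: app_times)

lemma power_ops: "t \<in> ops \<Longrightarrow> t ^ k \<in> ops \<and> opstar (t ^ k) = opstar t ^ k"
  by (induction k) (auto simp: power_commutes)

text \<open>
  The induction on \<open>k\<close> shows that \<open>x\<^sup>k\<close> is the Moore-Penrose inverse of \<open>t\<^sup>k\<close>: the polar decompositions of \<open>t\<close>,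
  \<open>t\<^sup>k\<close> and \<open>t\<^sup>k\<^sup>+\<^sup>1\<close> make \<open>t\<^sup>*t\<close> commute with \<open>t\<^sup>k(t\<^sup>k)\<^sup>*\<close>, and the reverse order law applies.
\<close>

lemma n_centered_mp:
  assumes t: "t \<in> ops" "moore_penrose t x" and n: "n_centered n (app t)"
  shows "n_centered n (app x)"
proof -
  obtain U where "polar_decomp (app t) U" and "\<forall>k\<in>{1..n}. polar_decomp (app t ^^ k) (U ^^ k)"
    using n by (auto simp: n_centered_def)
  moreover from polar_decompD[OF t(1) this(1)] obtain u where "U = app u" "polar t u" by metis
  ultimately have u: "polar_decomp (app t) (app u)" "polar t u"
      and k: "\<And>k. 1 \<le> k \<Longrightarrow> k \<le> n \<Longrightarrow> polar_decomp (app (t ^ k)) (app (u ^ k))"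
    by (auto simp: app_power)
  have B: "u \<in> ops" "x \<in> ops" using u(2) t(2) by (auto simp: polar_def moore_penrose_def)
  have pol: "polar (t ^ k) (u ^ k)" if "1 \<le> k" "k \<le> n" for k
    using polar_decompD[OF _ k[OF that]] power_ops[OF t(1)] by (metis app_inject)
  have mp: "moore_penrose (t ^ k) (x ^ k)" if "1 \<le> k" "k \<le> n" for k
    using that
  proof (induction k rule: dec_induct)
    case base
    then show ?case using t by simp
  next
    case (step k)
    have "polar (t * t ^ k) (u * u ^ k)" using pol[of "Suc k"] step by simp
    then have "opstar t * t * (t ^ k * opstar (t ^ k)) = t ^ k * opstar (t ^ k) * (opstar t * t)"
      using polar_mult_commute[OF t(1) u(2) _ pol] power_ops[OF t(1)] step by simp
    then have "moore_penrose (t * t ^ k) (x ^ k * x)"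
      using mp_mult[OF t(1) _ t(2)] power_ops[OF t(1)] step by simp
    then show ?case by (simp add: power_commutes)
  qed
  have "polar_decomp (app x ^^ k) (app (opstar u) ^^ k)" if "k \<in> {1..n}" for k
    using polar_decomp_mp[OF _ mp k, of k] that power_ops[OF t(1)] power_ops[OF B(1)]
    by (simp add: app_power)
  then show ?thesis
    unfolding n_centered_def using polar_decomp_mp[OF t u(1)] by blast
qed

theorem n_centered_MP_inverse_iff:
  assumes "adjointable T" "MP_invertible T"
  shows "n_centered n T \<longleftrightarrow> n_centered n (MP_inverse T)"
proof -
  define t where "t = Endo T"
  have t: "t \<in> ops" "app t = T" using Endo_ops[OF assms(1)] by (auto simp: t_def)
  obtain x where x: "moore_penrose t x"
    using assms(2) is_MP_inverse_iff[OF t(1)] by (auto simp: MP_invertible_def t(2))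
  have "MP_inverse T = app x"
    unfolding MP_inverse_def t(2)[symmetric] is_MP_inverse_iff[OF t(1)]
    using x mp_unique[OF t(1)] by blast
  moreover have "x \<in> ops" using x by (simp add: moore_penrose_def)
  ultimately show ?thesis
    using n_centered_mp[OF t(1) x] n_centered_mp[OF _ mp_sym[OF t(1) x]] t(2) by auto
qed

end

theorem theorem5p8:
  fixes act :: "'h::complex_banach \<Rightarrow> 'a::cstar_algebra \<Rightarrow> 'h"
    and ip :: "'h \<Rightarrow> 'h \<Rightarrow> 'a"
    and T U :: "'h \<Rightarrow> 'h"
    and n :: nat
  assumes "hilbert_module act ip"
    and "hilbert_module.adjointable ip T"
    and "hilbert_module.MP_invertible ip T"
    and "hilbert_module.polar_decomp act ip T U"
    and "n \<ge> 1"
  shows "hilbert_module.n_centered act ip n T \<longleftrightarrow>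
    hilbert_module.n_centered act ip n (hilbert_module.MP_inverse ip T)"
  using cauchy_schwarz_module.n_centered_MP_inverse_iff
    hilbert_module.cauchy_schwarz_module assms(1-3) by blast

end
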